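(* Fix $\Lambda>0$, a compact set $\mathcal K\Subset\mathcal P_\Lambda\cap\{|a|\le a_0\}$ ($a_0>0$ sufficiently small) and $n\in\mathbb N_0$. Choose $\ell\ge\max\{\ell_0,\ell_1\}$, so that the two-mode decomposition (A1) (valid for $\ell\ge\ell_1$) and the inverse map statement (A4) (valid for $\ell\ge\ell_0$) of the context hold, and let $(M,a)\in\mathcal K$ be the true parameters. Fix an observation window $[T_0,T_0+T]$ with $T_0\ge1$, a shift $\Delta\in(0,T)$ and a weight $w$ as in the context. Assume the inputs (A1)–(A4) of the context, and let $\varepsilon_\pm$ be the relative residual sizes defined there. If $\varepsilon_\pm\le\min\{1/8,|z_\pm|/20\}$ with $z_\pm=e^{-i\omega_{\pm,\ell}\Delta}$, then the reconstructed parameters $(\widehat M,\widehat a)$ satisfy $$|(\widehat M,\widehat a)-(M,a)|\le\frac{5\sqrt2\,C_*}{\Delta\,\ell}\left(\frac{\varepsilon_+}{|z_+|}+\frac{\varepsilon_-}{|z_-|}\right),$$ where $C_*$ is the inverse stability constant in (A4). Moreover, splitting $\varepsilon_\pm\le\varepsilon_\pm^{\mathrm{tail}}+\varepsilon_\pm^{\mathrm{meas}}$ with $$\varepsilon_\pm^{\mathrm{tail}}=\frac{\max\{\|\rho_{\pm,\ell}\|_w,\|S_\Delta\rho_{\pm,\ell}\|_w\}}{\|y_{0,\pm}\|_w},\qquad \varepsilon_\pm^{\mathrm{meas}}=\frac{\max\{\|\eta_\pm\|_w,\|S_\Delta\eta_\pm\|_w\}}{\|y_{0,\pm}\|_w},$$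 one has $$|(\widehat M,\widehat a)-(M,a)|\le\mathcal B_{\mathrm{tail}}+\mathcal B_{\mathrm{meas}},\qquad \mathcal B_{\bullet}=\frac{5\sqrt2\,C_*}{\Delta\,\ell}\left(\frac{\varepsilon^{\bullet}_+}{|z_+|}+\frac{\varepsilon^{\bullet}_-}{|z_-|}\right),\quad \bullet\in\{\mathrm{tail},\mathrm{meas}\}.$$ In particular, using the pointwise bound for $\rho_{\pm,\ell}$ in (A1) together with the two elementary inequalities (B1), (B2) of the context, one obtains explicit upper bounds for $\varepsilon^{\mathrm{tail}}_\pm$ (and hence for $\mathcal B_{\mathrm{tail}}$) in terms of $(T_0,T,\Delta,w)$, the tail decay rate $\nu$, and the amplitudes $a_{\pm,\ell}$.
   Context: **Setting.** $\mathcal P_\Lambda$ is the set of subextremal Kerr–de Sitter parameters $(M,a)$ (for which $(r^2+a^2)(1-\Lambda r^2/3)-2Mr$ has at least two distinct positive simple roots $0<r_e<r_c$, corresponding to the event and cosmological horizons). $P=\Box_{g_{M,a}}+V$ ($V$ smooth, stationary, axisymmetric) is the scalar wave operator on Kerr–de Sitter in future-horizon-regular coordinates $(t_*,r,\theta,\varphi_* )$, with spatial slice $X=[r_e-\delta,r_c+\delta]\times\mathbb S^2$ and physical part $X^{\mathrm{phys}}=(r_e,r_c)\times\mathbb S^2$; normalized so that $P=\partial_{t_*}^2+Q\partial_{t_*}+L$. $P(\omega)=L-i\omega Q-\omega^2$, and $R(\omega)=P(\omega)^{-1}$ is its meromorphically continued outgoing inverse, whose poles are the quasinormal modes (QNMs).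 $\mathcal H^s=H^{s+1}(X)\times H^s(X)$. For $0\le j\le n+1$, $\omega^\sharp_{j,\pm,\ell}(M,a)$ are the equatorial pseudopoles (approximate QNMs) in the azimuthal sector $k=\pm\ell$, with nearby simple QNMs $\omega_{j,\pm,\ell}$, $|\omega_{j,\pm,\ell}-\omega^\sharp_{j,\pm,\ell}|=\mathcal O(\ell^{-\infty})$ uniformly on $\mathcal K$; $\omega_{\pm,\ell}:=\omega_{n,\pm,\ell}$, $\omega^\sharp_{\pm,\ell}:=\omega^\sharp_{n,\pm,\ell}$; $\Im\omega_{\pm,\ell}\le 0$. **Refined signals.** Let $u$ solve $Pu=0$ with data $(f_0,f_1)$ at $t_*=0$ supported in a fixed compact $K_0\Subset X^{\mathrm{phys}}$. $\vartheta\in C^\infty(\mathbb R)$ equals $0$ for $t_*\le0$ and $1$ for $t_*\ge1$; $F_\vartheta=P(\vartheta u)$, $\widehat F_\vartheta(\omega)=\int_0^1e^{i\omega t_*}F_\vartheta\,dt_*$; $\chi\in C_c^\infty(X^{\mathrm{phys}})$ equals $1$ near the spatial support of $F_\vartheta$ for all such data. $\Pi_k$ projects onto $\partial_{\varphi_*}v=ikv$; $A_{\pm,h}=I_r\otimes\mathrm{Op}_h(a_\pm)$ with order-$0$ symbols on $T^*\mathbb S^2$, independent of $\varphi_*$, supported near and equal to $1$ in a smaller neighborhood of $\{\theta=\pi/2,\eta_\theta=0,\eta_\varphi=\pm1\}$, $a_+a_-=0$. $\widetilde g_{\pm,\ell}(\omega)=(\omega/\omega^\sharp_{\pm,\ell})^{n+2}\prod_{j=0}^{n-1}\frac{\omega-\omega^\sharp_{j,\pm,\ell}}{\omega^\sharp_{\pm,\ell}-\omega^\sharp_{j,\pm,\ell}}$.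 For $C$ large, $u^{(\pm,\ell)}(t)=\chi A_{\pm,1/\ell}\Pi_{\pm\ell}\frac1{2\pi}\int_{\Im\omega=C}e^{-i\omega t}\widetilde g_{\pm,\ell}(\omega)R(\omega)\widehat F_\vartheta(\omega)\,d\omega$. **(A1) Two-mode model and tail control.** For $t\ge1$, $u^{(\pm,\ell)}(t)=e^{-i\omega_{\pm,\ell}t}A_{\pm,\ell}+E_{\pm,\ell}(t)$ with $A_{\pm,\ell}\in H^{s+1}(X)$ depending linearly on the data. With a bounded linear functional (detector) $\mathsf O:H^{s+1}(X)\to\mathbb C$, put $a_{\pm,\ell}=\mathsf O(A_{\pm,\ell})$ and $\rho_{\pm,\ell}(t)=\mathsf O(E_{\pm,\ell}(t))$, so that $\mathsf O(u^{(\pm,\ell)}(t))=a_{\pm,\ell}e^{-i\omega_{\pm,\ell}t}+\rho_{\pm,\ell}(t)$. For all $m,N'\in\mathbb N$ and $t\ge1$, $|\rho_{\pm,\ell}(t)|\le\|\mathsf O\|\,\|E_{\pm,\ell}(t)\|_{H^{s+1}}\le C_{s,m,N'}\|\mathsf O\|(e^{-\nu t}(1+t)^{-m}+\ell^{-N'})\|(f_0,f_1)\|_{\mathcal H^{s+m+N_{m,N'}}}$, uniformly on $\mathcal K$ and in $\ell\ge\ell_1$. Here $\nu>0$ is the height of a uniformly pole-separated line $\Im\omega=-\nu$ lying between the $n$th and $(n+1)$st equatorial overtone layers. **(A2) Detectability.** $a_{+,\ell}\neq0$ and $a_{-,\ell}\neq0$. **Measured data.** $y_{0,\pm}(t)=a_{\pm,\ell}e^{-i\omega_{\pm,\ell}t}$.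 The measured signals on $[T_0,T_0+T]$ are $\widetilde y_\pm=\mathsf O(u^{(\pm,\ell)})+\eta_\pm=y_{0,\pm}+r_\pm$, $r_\pm=\rho_{\pm,\ell}+\eta_\pm$, with $\eta_\pm$ a deterministic measurement perturbation. The weight $w\in L^\infty([T_0,T_0+T-\Delta])$ satisfies $0\le w\le1$ and $w\equiv1$ on $[T_0+\Delta,T_0+T-2\Delta]$; $\langle f,g\rangle_w=\int_{T_0}^{T_0+T-\Delta}wf\bar g\,dt$, $\|f\|_w^2=\langle f,f\rangle_w$, $(S_\Delta f)(t)=f(t+\Delta)$. $\varepsilon_\pm=\max\{\|r_\pm\|_w,\|S_\Delta r_\pm\|_w\}/\|y_{0,\pm}\|_w$. **(A3) Frequency extraction.** $\widehat z_\pm=\langle S_\Delta\widetilde y_\pm,\widetilde y_\pm\rangle_w/\langle\widetilde y_\pm,\widetilde y_\pm\rangle_w$ and $\widehat\omega_\pm=\frac i\Delta\operatorname{Log}(\widehat z_\pm)$, where the logarithm branch is chosen consistently with the prior $\omega^\sharp_{\pm,\ell}$: $\operatorname{Log}(\zeta)=\operatorname{Log}_{\mathrm{principal}}(\zeta/z^\sharp_\pm)-i\omega^\sharp_{\pm,\ell}\Delta$, $z^\sharp_\pm=e^{-i\omega^\sharp_{\pm,\ell}\Delta}$ (branch selection in the regime $|z_\pm-z^\sharp_\pm|\le\frac14|z^\sharp_\pm|$, $|\widehat z_\pm-z_\pm|\le\frac12|z_\pm|$). When $\varepsilon_\pm\le\min\{1/8,|z_\pm|/20\}$, the frequency errors obey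 $|\widehat\omega_\pm-\omega_{\pm,\ell}|\le\frac{10}{\Delta|z_\pm|}\varepsilon_\pm$. **(A4) Inverse map (companion-paper input).** $U_\ell=\Re\frac{\omega_{+,\ell}+\omega_{-,\ell}}{2\ell}$, $V_\ell=\Re\frac{\omega_{+,\ell}-\omega_{-,\ell}}{2\ell}$; $\mathcal G_\ell=(U_\ell,V_\ell):\mathcal K\to\mathbb R^2$ is real-analytic and locally invertible at every point of $\mathcal K$, with $|\det D\mathcal G_\ell|$ bounded below on $\mathcal K$ by a positive constant independent of $\ell\ge\ell_0$, and $|p-p'|\le C_*|\mathcal G_\ell(p)-\mathcal G_\ell(p')|$ for all $p,p'\in\mathcal K$ sufficiently close. With $\widehat{\mathcal G}_\ell=\big(\Re\frac{\widehat\omega_++\widehat\omega_-}{2\ell},\Re\frac{\widehat\omega_+-\widehat\omega_-}{2\ell}\big)$, the reconstructed parameters are $(\widehat M,\widehat a)=\mathcal G_\ell^{-1}(\widehat{\mathcal G}_\ell)$, where $\mathcal G_\ell^{-1}$ is the local inverse of $\mathcal G_\ell$ on a neighborhood of the true point $(M,a)$. **(B1)** $\max\{\|f\|_w,\|S_\Delta f\|_w\}\le\|f\|_{L^2([T_0,T_0+T])}$ for $f\in L^2([T_0,T_0+T])$. **(B2)** For $y_0(t)=ae^{-i\omega t}$ with $a\ne0$, $\Im\omega<0$: $\|y_0\|_w^2\ge|a|^2\int_{T_0+\Delta}^{T_0+T-2\Delta}e^{2\Im\omega\,t}\,dt$, and in particular $\|y_0\|_w\ge|a|e^{\Im\omega(T_0+T-2\Delta)}\sqrt{T-3\Delta}$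 if $T>3\Delta$. *)

theory Defs
  imports "HOL-Complex_Analysis.Complex_Analysis"
begin

section \<open>Smooth functions, test functions, Sobolev spaces\<close>

type_synonym field = "real^3 \<Rightarrow> complex"
type_synonym param = "real \<times> real"      \<comment> \<open>the pair \<open>(M, a)\<close>\<close>
type_synonym data = "field \<times> field"      \<comment> \<open>the pair \<open>(f\<^sub>0, f\<^sub>1)\<close>\<close>

text \<open>For open \<open>S\<close>: all iterated partial derivatives exist and are (Frechet) differentiable
  on \<open>S\<close>, i.e. \<open>f\<close> is of class C-infinity there.\<close>

definition smooth_on :: "'a::euclidean_space set \<Rightarrow> ('a \<Rightarrow> 'b::real_normed_vector) \<Rightarrow> bool" where
  "smooth_on S f \<longleftrightarrow> open S \<and>
     (\<forall>vs. set vs \<subseteq> Basis \<longrightarrow>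
        fold (\<lambda>b g x. frechet_derivative g (at x) b) vs f differentiable_on S)"

definition test_fun :: "'a::euclidean_space set \<Rightarrow> ('a \<Rightarrow> complex) \<Rightarrow> bool" where
  "test_fun S \<phi> \<longleftrightarrow> smooth_on UNIV \<phi> \<and> compact (closure {x. \<phi> x \<noteq> 0}) \<and> closure {x. \<phi> x \<noteq> 0} \<subseteq> S"

definition L2_on :: "'a::euclidean_space set \<Rightarrow> ('a \<Rightarrow> complex) \<Rightarrow> bool" where
  "L2_on S u \<longleftrightarrow> u \<in> borel_measurable (lebesgue_on S) \<and>
     integrable (lebesgue_on S) (\<lambda>x. (cmod (u x))\<^sup>2)"

definition fourier_test :: "field \<Rightarrow> field" where
  "fourier_test \<psi> x = complex_of_real ((2 * pi) powr (- 3 / 2)) *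
     integral\<^sup>L lebesgue (\<lambda>\<xi>. exp (- \<i> * complex_of_real (x \<bullet> \<xi>)) * \<psi> \<xi>)"

text \<open>\<open>V\<close> is the Fourier--Plancherel transform of the square-integrable function \<open>U\<close>, by duality.\<close>

definition is_fourier :: "field \<Rightarrow> field \<Rightarrow> bool" where
  "is_fourier U V \<longleftrightarrow> L2_on UNIV U \<and> L2_on UNIV V \<and>
     (\<forall>\<psi>. test_fun UNIV \<psi> \<longrightarrow>
        integral\<^sup>L lebesgue (\<lambda>\<xi>. V \<xi> * \<psi> \<xi>) = integral\<^sup>L lebesgue (\<lambda>x. U x * fourier_test \<psi> x))"

definition sobolev_R3 :: "real \<Rightarrow> field \<Rightarrow> bool" where
  "sobolev_R3 s U \<longleftrightarrow> (\<exists>V. is_fourier U V \<and>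
     integrable lebesgue (\<lambda>\<xi>. (1 + (norm \<xi>)\<^sup>2) powr s * (cmod (V \<xi>))\<^sup>2))"

definition sobolev_R3_norm :: "real \<Rightarrow> field \<Rightarrow> real" where
  "sobolev_R3_norm s U =
     sqrt (integral\<^sup>L lebesgue
       (\<lambda>\<xi>. (1 + (norm \<xi>)\<^sup>2) powr s * (cmod ((SOME V. is_fourier U V) \<xi>))\<^sup>2))"

text \<open>\<open>H\<^sup>s(X)\<close> is the space of restrictions (extendible distributions) with the quotient norm,
  for \<open>s \<ge> 0\<close>.  Elements are functions, identified when equal almost everywhere on \<open>X\<close>.\<close>

definition sobolev :: "(real^3) set \<Rightarrow> real \<Rightarrow> field \<Rightarrow> bool" where
  "sobolev X s u \<longleftrightarrow> (\<exists>U. sobolev_R3 s U \<and> (AE x in lebesgue_on X. u x = U x))"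

definition sobolev_norm :: "(real^3) set \<Rightarrow> real \<Rightarrow> field \<Rightarrow> real" where
  "sobolev_norm X s u =
     Inf {sobolev_R3_norm s U | U. sobolev_R3 s U \<and> (AE x in lebesgue_on X. u x = U x)}"

text \<open>\<open>\<H>\<^sup>s = H\<^bsup>s+1\<^esup>(X) \<times> H\<^sup>s(X)\<close>\<close>

definition energy_space :: "(real^3) set \<Rightarrow> real \<Rightarrow> data \<Rightarrow> bool" where
  "energy_space X s d \<longleftrightarrow> sobolev X (s + 1) (fst d) \<and> sobolev X s (snd d)"

definition energy_norm :: "(real^3) set \<Rightarrow> real \<Rightarrow> data \<Rightarrow> real" where
  "energy_norm X s d =
     sqrt ((sobolev_norm X (s + 1) (fst d))\<^sup>2 + (sobolev_norm X s (snd d))\<^sup>2)"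

text \<open>Bounded linear functionals on \<open>H\<^sup>s(X)\<close> and their norm.\<close>

definition detector :: "(real^3) set \<Rightarrow> real \<Rightarrow> (field \<Rightarrow> complex) \<Rightarrow> bool" where
  "detector X s Ob \<longleftrightarrow>
     (\<forall>u v c. sobolev X s u \<longrightarrow> sobolev X s v \<longrightarrow> Ob (\<lambda>x. c * u x + v x) = c * Ob u + Ob v) \<and>
     (\<exists>B\<ge>0. \<forall>u. sobolev X s u \<longrightarrow> cmod (Ob u) \<le> B * sobolev_norm X s u)"

definition detector_norm :: "(real^3) set \<Rightarrow> real \<Rightarrow> (field \<Rightarrow> complex) \<Rightarrow> real" where
  "detector_norm X s Ob =
     Inf {B. 0 \<le> B \<and> (\<forall>u. sobolev X s u \<longrightarrow> cmod (Ob u) \<le> B * sobolev_norm X s u)}"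


section \<open>Subextremal Kerr--de Sitter parameters\<close>

definition horizon_poly :: "real \<Rightarrow> param \<Rightarrow> real poly" where
  "horizon_poly Lam p = (case p of (M, a) \<Rightarrow>
     [:a\<^sup>2, 0, 1:] * [:1, 0, - Lam / 3:] - [:0, 2 * M:])"

definition subextremal :: "real \<Rightarrow> param set" where
  "subextremal Lam = {p. \<exists>re rc. 0 < re \<and> re < rc \<and>
     order re (horizon_poly Lam p) = 1 \<and> order rc (horizon_poly Lam p) = 1}"

text \<open>The cosmological and event horizons are the two largest positive roots: by the rule of signs
  a polynomial with two distinct positive simple roots either has exactly those two positive roots
  or has a third, smaller one (the Cauchy horizon).\<close>

definition r_cosm :: "real \<Rightarrow> param \<Rightarrow> real" where
  "r_cosm Lam p = Max {r. 0 < r \<and> poly (horizon_poly Lam p) r = 0}"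

definition r_event :: "real \<Rightarrow> param \<Rightarrow> real" where
  "r_event Lam p = Max {r. 0 < r \<and> r < r_cosm Lam p \<and> poly (horizon_poly Lam p) r = 0}"


section \<open>The wave operator in future-horizon-regular coordinates\<close>

text \<open>With \<open>\<alpha> = \<Lambda>a\<^sup>2/3\<close>, \<open>\<Delta>\<^sub>r\<close> = \<open>horizon_poly\<close>, \<open>\<Delta>\<^sub>\<theta> = 1 + \<alpha> cos\<^sup>2\<theta>\<close>,
  \<open>\<rho>\<^sup>2 = r\<^sup>2 + a\<^sup>2 cos\<^sup>2\<theta>\<close>, the dual metric (signature \<open>-+++\<close>) and volume form in Boyer--Lindquist
  coordinates \<open>(t, r, \<theta>, \<phi>)\<close> are
  \<open>\<rho>\<^sup>2 G = \<Delta>\<^sub>r \<partial>\<^sub>r\<^sup>2 + \<Delta>\<^sub>\<theta> \<partial>\<^sub>\<theta>\<^sup>2 + (1+\<alpha>)\<^sup>2 (a sin\<^sup>2\<theta> \<partial>\<^sub>t + \<partial>\<^sub>\<phi>)\<^sup>2 / (\<Delta>\<^sub>\<theta> sin\<^sup>2\<theta>)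
     - (1+\<alpha>)\<^sup>2 ((r\<^sup>2+a\<^sup>2) \<partial>\<^sub>t + a \<partial>\<^sub>\<phi>)\<^sup>2 / \<Delta>\<^sub>r\<close> and
  \<open>dvol = (1+\<alpha>)\<^sup>-\<^sup>2 \<rho>\<^sup>2 sin \<theta> dt dr d\<theta> d\<phi>\<close>.

  Regular coordinates are \<open>t\<^sub>* = t - F(r)\<close>, \<open>\<phi>\<^sub>* = \<phi> - \<Phi>(r)\<close>, so that \<open>\<partial>\<^sub>r\<close> becomes
  \<open>\<partial>\<^sub>r - F' \<partial>\<^sub>t\<^sub>* - \<Phi>' \<partial>\<^sub>\<phi>\<^sub>*\<close>.  The choice of \<open>F, \<Phi>\<close> is recorded by the functions
  \<open>gauge_t = \<Delta>\<^sub>r F'\<close> and \<open>gauge_phi = \<Delta>\<^sub>r \<Phi>'\<close>, which extend smoothly across the horizons.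

  The spatial slice \<open>[r\<^sub>e - \<delta>, r\<^sub>c + \<delta>] \<times> S\<^sup>2\<close> is realised as a spherical shell in three-space.
  Stationarity of the potential is built in, since it depends on the spatial variable only.\<close>

record kds_background =
  Lam :: real
  collar :: real                                      \<comment> \<open>the number \<open>\<delta>\<close>\<close>
  gauge_t :: "param \<Rightarrow> real \<Rightarrow> real"
  gauge_phi :: "param \<Rightarrow> real \<Rightarrow> real"
  potential :: "param \<Rightarrow> real^3 \<Rightarrow> complex"

definition X_slice :: "kds_background \<Rightarrow> param \<Rightarrow> (real^3) set" where
  "X_slice B p = {x. r_event (Lam B) p - collar B \<le> norm x \<and> norm x \<le> r_cosm (Lam B) p + collar B}"

definition X_phys :: "kds_background \<Rightarrow> param \<Rightarrow> (real^3) set" where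
  "X_phys B p = {x. r_event (Lam B) p < norm x \<and> norm x < r_cosm (Lam B) p}"

definition sph :: "real \<Rightarrow> real \<Rightarrow> real \<Rightarrow> real^3" where
  "sph r \<theta> \<phi> = vector [r * sin \<theta> * cos \<phi>, r * sin \<theta> * sin \<phi>, r * cos \<theta>]"

definition colat :: "real^3 \<Rightarrow> real" where
  "colat x = arccos (x $ 3 / norm x)"

definition azim :: "real^3 \<Rightarrow> real" where
  "azim x = Arg (Complex (x $ 1) (x $ 2))"

definition rot :: "real \<Rightarrow> real^3 \<Rightarrow> real^3" where
  "rot \<tau> x = vector [cos \<tau> * x $ 1 - sin \<tau> * x $ 2, sin \<tau> * x $ 1 + cos \<tau> * x $ 2, x $ 3]"

text \<open>Coordinate vector fields acting on functions (meaningful off the polar axis, a null set).\<close>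

definition d_r :: "field \<Rightarrow> field" where
  "d_r f x = vector_derivative (\<lambda>q. f (sph q (colat x) (azim x))) (at (norm x))"

definition d_theta :: "field \<Rightarrow> field" where
  "d_theta f x = vector_derivative (\<lambda>\<tau>. f (sph (norm x) \<tau> (azim x))) (at (colat x))"

definition d_phi :: "field \<Rightarrow> field" where
  "d_phi f x = vector_derivative (\<lambda>\<tau>. f (sph (norm x) (colat x) \<tau>)) (at (azim x))"

definition Delta_r :: "kds_background \<Rightarrow> param \<Rightarrow> real \<Rightarrow> real" where
  "Delta_r B p r = poly (horizon_poly (Lam B) p) r"

definition alpha :: "kds_background \<Rightarrow> param \<Rightarrow> real" where
  "alpha B p = Lam B * (snd p)\<^sup>2 / 3"

definition Delta_theta :: "kds_background \<Rightarrow> param \<Rightarrow> real^3 \<Rightarrow> real" where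
  "Delta_theta B p x = 1 + alpha B p * (cos (colat x))\<^sup>2"

definition rho_sq :: "param \<Rightarrow> real^3 \<Rightarrow> real" where
  "rho_sq p x = (norm x)\<^sup>2 + (snd p)\<^sup>2 * (cos (colat x))\<^sup>2"

text \<open>Components of \<open>\<rho>\<^sup>2 G\<close> in the coordinates \<open>(t\<^sub>*, r, \<theta>, \<phi>\<^sub>*)\<close> (besides
  \<open>\<Delta>\<^sub>r\<close> and \<open>\<Delta>\<^sub>\<theta>\<close>).  The quotients by \<open>\<Delta>\<^sub>r\<close> have removable singularities
  at the horizons, which is why they are written as limits.\<close>

definition G_tt :: "kds_background \<Rightarrow> param \<Rightarrow> real^3 \<Rightarrow> real" where
  "G_tt B p x = (1 + alpha B p)\<^sup>2 * (snd p)\<^sup>2 * (sin (colat x))\<^sup>2 / Delta_theta B p x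
     + Lim (at (norm x)) (\<lambda>r. ((gauge_t B p r)\<^sup>2 - (1 + alpha B p)\<^sup>2 * (r\<^sup>2 + (snd p)\<^sup>2)\<^sup>2) / Delta_r B p r)"

definition G_tphi :: "kds_background \<Rightarrow> param \<Rightarrow> real^3 \<Rightarrow> real" where
  "G_tphi B p x = (1 + alpha B p)\<^sup>2 * snd p / Delta_theta B p x
     + Lim (at (norm x)) (\<lambda>r. (gauge_t B p r * gauge_phi B p r
                              - (1 + alpha B p)\<^sup>2 * snd p * (r\<^sup>2 + (snd p)\<^sup>2)) / Delta_r B p r)"

definition G_phiphi :: "kds_background \<Rightarrow> param \<Rightarrow> real^3 \<Rightarrow> real" where
  "G_phiphi B p x = (1 + alpha B p)\<^sup>2 / (Delta_theta B p x * (sin (colat x))\<^sup>2)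
     + Lim (at (norm x)) (\<lambda>r. ((gauge_phi B p r)\<^sup>2 - (1 + alpha B p)\<^sup>2 * (snd p)\<^sup>2) / Delta_r B p r)"

definition G_tr :: "kds_background \<Rightarrow> param \<Rightarrow> real^3 \<Rightarrow> real" where
  "G_tr B p x = - gauge_t B p (norm x)"

definition G_rphi :: "kds_background \<Rightarrow> param \<Rightarrow> real^3 \<Rightarrow> real" where
  "G_rphi B p x = - gauge_phi B p (norm x)"

text \<open>Dividing \<open>\<rho>\<^sup>2 (\<box> + V)\<close>, with \<open>\<box> u = |g|\<^sup>-\<^sup>1\<^sup>/\<^sup>2 \<partial>\<^sub>i (|g|\<^sup>1\<^sup>/\<^sup>2 G\<^sup>i\<^sup>j \<partial>\<^sub>j u)\<close>,
  by the coefficient of \<open>\<partial>\<^sub>t\<^sub>*\<^sup>2\<close> gives \<open>P = \<partial>\<^sub>t\<^sub>*\<^sup>2 + Q \<partial>\<^sub>t\<^sub>* + L\<close> with the following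
  stationary operators.\<close>

definition Q_op :: "kds_background \<Rightarrow> param \<Rightarrow> field \<Rightarrow> field" where
  "Q_op B p f x =
     (2 * complex_of_real (G_tphi B p x) * d_phi f x
      + complex_of_real (G_tr B p x) * d_r f x
      + d_r (\<lambda>y. complex_of_real (G_tr B p y) * f y) x) / complex_of_real (G_tt B p x)"

definition L_op :: "kds_background \<Rightarrow> param \<Rightarrow> field \<Rightarrow> field" where
  "L_op B p f x =
     (d_r (\<lambda>y. complex_of_real (Delta_r B p (norm y)) * d_r f y) x
      + complex_of_real (G_rphi B p x) * d_phi (d_r f) x
      + d_r (\<lambda>y. complex_of_real (G_rphi B p y) * d_phi f y) x
      + complex_of_real (G_phiphi B p x) * d_phi (d_phi f) x
      + d_theta (\<lambda>y. complex_of_real (sin (colat y) * Delta_theta B p y) * d_theta f y) x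
          / complex_of_real (sin (colat x))
      + complex_of_real (rho_sq p x) * potential B p x * f x) / complex_of_real (G_tt B p x)"

definition P_op :: "kds_background \<Rightarrow> param \<Rightarrow> complex \<Rightarrow> field \<Rightarrow> field" where
  "P_op B p \<omega> f x = L_op B p f x - \<i> * \<omega> * Q_op B p f x - \<omega>\<^sup>2 * f x"

definition background_ok :: "kds_background \<Rightarrow> param set \<Rightarrow> bool" where
  "background_ok B K \<longleftrightarrow> 0 < Lam B \<and> 0 < collar B \<and>
     (\<forall>p\<in>K. let re = r_event (Lam B) p; rc = r_cosm (Lam B) p; \<delta> = collar B in
        0 < re - \<delta> \<and>
        (\<forall>r\<in>{re - \<delta>..rc + \<delta>}. Delta_r B p r = 0 \<longrightarrow> r = re \<or> r = rc) \<and>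
        (\<exists>S. {re - \<delta>..rc + \<delta>} \<subseteq> S \<and> smooth_on S (gauge_t B p) \<and> smooth_on S (gauge_phi B p)) \<and>
        gauge_t B p re = - (1 + alpha B p) * (re\<^sup>2 + (snd p)\<^sup>2) \<and>
        gauge_t B p rc = (1 + alpha B p) * (rc\<^sup>2 + (snd p)\<^sup>2) \<and>
        gauge_phi B p re = - (1 + alpha B p) * snd p \<and>
        gauge_phi B p rc = (1 + alpha B p) * snd p \<and>
        (\<forall>x\<in>X_slice B p. G_tt B p x < 0) \<and>
        (\<exists>S. X_slice B p \<subseteq> S \<and> smooth_on S (potential B p)) \<and>
        (\<forall>x\<in>X_slice B p. \<forall>\<tau>. potential B p (rot \<tau> x) = potential B p x))"

text \<open>Bilinear pairing over \<open>X\<close> against the density for which \<open>P\<close> is formally symmetric, i.e.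
  \<open>\<rho>\<^sup>2 G\<^sup>t\<^sup>t sin \<theta> dr d\<theta> d\<phi>\<close>; the Euclidean volume is \<open>r\<^sup>2 sin \<theta> dr d\<theta> d\<phi>\<close>.
  On functions compactly supported in the interior the transpose of \<open>L\<close> is \<open>L\<close>, that of \<open>Q\<close> is
  \<open>-Q\<close>, hence that of \<open>P(\<omega>)\<close> is \<open>P(-\<omega>)\<close>.\<close>

definition pairing :: "kds_background \<Rightarrow> param \<Rightarrow> field \<Rightarrow> field \<Rightarrow> complex" where
  "pairing B p u \<phi> =
     integral\<^sup>L (lebesgue_on (X_slice B p))
       (\<lambda>x. u x * \<phi> x * complex_of_real (G_tt B p x / (norm x)\<^sup>2))"

abbreviation tests :: "kds_background \<Rightarrow> param \<Rightarrow> field set" where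
  "tests B p \<equiv> {\<phi>. test_fun (interior (X_slice B p)) \<phi>}"

text \<open>\<open>P(\<omega>) u = f\<close> in the sense of distributions on the interior of \<open>X\<close>.\<close>

definition solves_stationary :: "kds_background \<Rightarrow> param \<Rightarrow> complex \<Rightarrow> field \<Rightarrow> field \<Rightarrow> bool" where
  "solves_stationary B p \<omega> u f \<longleftrightarrow>
     (\<forall>\<phi>\<in>tests B p. pairing B p u (P_op B p (- \<omega>) \<phi>) = pairing B p f \<phi>)"

text \<open>The distribution \<open>P w\<close> at time \<open>t\<close>, evaluated on a spatial test function.\<close>

definition wave_dist :: "kds_background \<Rightarrow> param \<Rightarrow> (real \<Rightarrow> field) \<Rightarrow> field \<Rightarrow> real \<Rightarrow> complex" where
  "wave_dist B p w \<phi> t =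
     vector_derivative (\<lambda>\<tau>. vector_derivative (\<lambda>\<sigma>. pairing B p (w \<sigma>) \<phi>) (at \<tau>)) (at t)
     - vector_derivative (\<lambda>\<tau>. pairing B p (w \<tau>) (Q_op B p \<phi>)) (at t)
     + pairing B p (w t) (L_op B p \<phi>)"

text \<open>\<open>u \<in> C\<^sup>0([0,\<infinity>); H\<^bsup>s+1\<^esup>) \<inter> C\<^sup>1([0,\<infinity>); H\<^sup>s)\<close>, \<open>P u = 0\<close>, with Cauchy data \<open>d\<close> at \<open>t\<^sub>* = 0\<close>.\<close>

definition wave_solution :: "kds_background \<Rightarrow> real \<Rightarrow> param \<Rightarrow> data \<Rightarrow> (real \<Rightarrow> field) \<Rightarrow> bool" where
  "wave_solution B s p d u \<longleftrightarrow> (\<exists>v. let X = X_slice B p in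
     (\<forall>t\<ge>0. sobolev X (s + 1) (u t) \<and> sobolev X s (v t) \<and>
        ((\<lambda>\<tau>. sobolev_norm X (s + 1) (\<lambda>x. u \<tau> x - u t x)) \<longlongrightarrow> 0) (at t within {0..}) \<and>
        ((\<lambda>\<tau>. sobolev_norm X s (\<lambda>x. v \<tau> x - v t x)) \<longlongrightarrow> 0) (at t within {0..}) \<and>
        ((\<lambda>\<tau>. sobolev_norm X s (\<lambda>x. (u \<tau> x - u t x) / complex_of_real (\<tau> - t) - v t x)) \<longlongrightarrow> 0)
           (at t within {0..})) \<and>
     (AE x in lebesgue_on X. u 0 x = fst d x) \<and>
     (AE x in lebesgue_on X. v 0 x = snd d x) \<and>
     (\<forall>\<phi>\<in>tests B p. \<forall>t>0. (\<lambda>\<tau>. pairing B p (v \<tau>) \<phi>) differentiable (at t) \<and>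
        wave_dist B p u \<phi> t = 0))"

definition wave_evolution :: "kds_background \<Rightarrow> real \<Rightarrow> param \<Rightarrow> data \<Rightarrow> real \<Rightarrow> field" where
  "wave_evolution B s p d = (SOME u. wave_solution B s p d u)"


section \<open>Resolvent and quasinormal modes\<close>

text \<open>For \<open>Im \<omega>\<close> large, \<open>P(\<omega>)\<close> is invertible, with inverse from \<open>H\<^sup>s(X)\<close> to \<open>H\<^bsup>s+1\<^esup>(X)\<close>; the value is
  determined up to null sets.\<close>

definition resolvent :: "kds_background \<Rightarrow> real \<Rightarrow> param \<Rightarrow> complex \<Rightarrow> field \<Rightarrow> field" where
  "resolvent B s p \<omega> f = (SOME u. sobolev (X_slice B p) (s + 1) u \<and> solves_stationary B p \<omega> u f)"

text \<open>\<open>m\<close> is the meromorphic continuation to the whole plane of the matrix element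
  \<open>\<omega> \<mapsto> \<langle>R(\<omega>) f, \<phi>\<rangle>\<close>, with \<open>f\<close> smooth up to the boundary of \<open>X\<close> and lying in the azimuthal
  sector \<open>k\<close>.\<close>

definition resolvent_element ::
  "kds_background \<Rightarrow> real \<Rightarrow> param \<Rightarrow> int \<Rightarrow> field \<Rightarrow> field \<Rightarrow> (complex \<Rightarrow> complex) \<Rightarrow> bool" where
  "resolvent_element B s p k f \<phi> m \<longleftrightarrow>
     (\<exists>S. X_slice B p \<subseteq> S \<and> smooth_on S f) \<and>
     (\<forall>x\<in>X_slice B p. \<forall>\<tau>. f (rot \<tau> x) = exp (\<i> * of_int k * complex_of_real \<tau>) * f x) \<and>
     \<phi> \<in> tests B p \<and> m meromorphic_on UNIV \<and>
     (\<exists>C. \<forall>\<omega>. C < Im \<omega> \<longrightarrow> m \<omega> = pairing B p (resolvent B s p \<omega> f) \<phi>)"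

definition qnm :: "kds_background \<Rightarrow> real \<Rightarrow> param \<Rightarrow> int \<Rightarrow> complex \<Rightarrow> bool" where
  "qnm B s p k \<omega> \<longleftrightarrow> (\<exists>f \<phi> m. resolvent_element B s p k f \<phi> m \<and> is_pole m \<omega>)"

text \<open>Simple: a first-order pole of the resolvent in the sector whose residue has rank one.\<close>

definition simple_qnm :: "kds_background \<Rightarrow> real \<Rightarrow> param \<Rightarrow> int \<Rightarrow> complex \<Rightarrow> bool" where
  "simple_qnm B s p k \<omega> \<longleftrightarrow> qnm B s p k \<omega> \<and>
     (\<forall>f \<phi> m. resolvent_element B s p k f \<phi> m \<longrightarrow> is_pole m \<omega> \<longrightarrow> zorder m \<omega> = -1) \<and>
     (\<exists>b c. \<forall>f \<phi> m. resolvent_element B s p k f \<phi> m \<longrightarrow> residue m \<omega> = b f * c \<phi>)"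

datatype pm = Plus | Minus

definition azimuthal :: "pm \<Rightarrow> nat \<Rightarrow> int" where
  "azimuthal \<sigma> l = (case \<sigma> of Plus \<Rightarrow> int l | Minus \<Rightarrow> - int l)"

text \<open>\<open>Ws j \<sigma> l p\<close> is the equatorial pseudopole \<open>\<omega>\<^sup>\<sharp>\<close> and \<open>W j \<sigma> l p\<close> the nearby simple QNM.\<close>

type_synonym poles = "nat \<Rightarrow> pm \<Rightarrow> nat \<Rightarrow> param \<Rightarrow> complex"

definition equatorial_qnms ::
  "kds_background \<Rightarrow> real \<Rightarrow> param set \<Rightarrow> nat \<Rightarrow> nat \<Rightarrow> poles \<Rightarrow> poles \<Rightarrow> bool" where
  "equatorial_qnms B s K n lmin Ws W \<longleftrightarrow>
     (\<forall>p\<in>K. \<forall>\<sigma>. \<forall>l\<ge>lmin. \<forall>j\<le>n + 1. simple_qnm B s p (azimuthal \<sigma> l) (W j \<sigma> l p)) \<and>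
     (\<forall>N::nat. \<exists>C. \<forall>p\<in>K. \<forall>\<sigma>. \<forall>l\<ge>lmin. \<forall>j\<le>n + 1. cmod (W j \<sigma> l p - Ws j \<sigma> l p) \<le> C / real l ^ N) \<and>
     (\<forall>p\<in>K. \<forall>\<sigma>. \<forall>l\<ge>lmin. Im (W n \<sigma> l p) \<le> 0)"

text \<open>The line \<open>Im \<omega> = -\<nu>\<close> lies between the layers \<open>n\<close> and \<open>n + 1\<close>, at a positive distance,
  uniform in the parameters and in \<open>l\<close>, from the poles in the sectors \<open>k = \<plusminus>l\<close>.\<close>

definition separating_line ::
  "kds_background \<Rightarrow> real \<Rightarrow> param set \<Rightarrow> nat \<Rightarrow> nat \<Rightarrow> poles \<Rightarrow> real \<Rightarrow> bool" where
  "separating_line B s K n lmin W \<nu> \<longleftrightarrow> 0 < \<nu> \<and>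
     (\<exists>\<delta>>0. \<forall>p\<in>K. \<forall>\<sigma>. \<forall>l\<ge>lmin.
        Im (W (n + 1) \<sigma> l p) < - \<nu> \<and> - \<nu> < Im (W n \<sigma> l p) \<and>
        (\<forall>\<omega>. qnm B s p (azimuthal \<sigma> l) \<omega> \<longrightarrow> \<delta> \<le> \<bar>Im \<omega> + \<nu>\<bar>))"


section \<open>Filtered signals\<close>

record signal_filter =
  reg :: real                                         \<comment> \<open>the Sobolev order \<open>s\<close>\<close>
  K_supp :: "(real^3) set"                            \<comment> \<open>the set \<open>K\<^sub>0\<close>\<close>
  switch :: "real \<Rightarrow> real"                            \<comment> \<open>the function \<open>\<vartheta>\<close>\<close>
  chi :: field
  symb :: "pm \<Rightarrow> real \<times> real \<times> real \<Rightarrow> complex"       \<comment> \<open>\<open>a\<^sub>\<plusminus>(\<theta>, \<eta>\<^sub>\<theta>, \<eta>\<^sub>\<phi>)\<close>\<close>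
  chart_cut :: "real \<Rightarrow> real"                         \<comment> \<open>cutoff in \<open>\<theta>\<close> used by the quantization\<close>

definition data_space :: "kds_background \<Rightarrow> signal_filter \<Rightarrow> param \<Rightarrow> real \<Rightarrow> data set" where
  "data_space B Fl p s' = {d. energy_space (X_slice B p) s' d \<and>
     (\<forall>x. x \<notin> K_supp Fl \<longrightarrow> fst d x = 0 \<and> snd d x = 0)}"

text \<open>\<open>F\<^sub>\<vartheta> = P(\<vartheta> u)\<close> at time \<open>t\<close>, evaluated on a test function; and
  \<open>\<integral>\<^sub>0\<^sup>1 e\<^bsup>i\<omega>t\<^esup> F\<^sub>\<vartheta> dt\<close>, an element of \<open>H\<^sup>s(X)\<close>.\<close>

definition forcing :: "kds_background \<Rightarrow> signal_filter \<Rightarrow> param \<Rightarrow> data \<Rightarrow> field \<Rightarrow> real \<Rightarrow> complex" where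
  "forcing B Fl p d =
     wave_dist B p (\<lambda>t x. complex_of_real (switch Fl t) * wave_evolution B (reg Fl) p d t x)"

definition forcing_hat :: "kds_background \<Rightarrow> signal_filter \<Rightarrow> param \<Rightarrow> data \<Rightarrow> complex \<Rightarrow> field" where
  "forcing_hat B Fl p d \<omega> = (SOME f. sobolev (X_slice B p) (reg Fl) f \<and>
     (\<forall>\<phi>\<in>tests B p. pairing B p f \<phi> =
        (LINT t:{0..1}|lebesgue. exp (\<i> * \<omega> * complex_of_real t) * forcing B Fl p d \<phi> t)))"

definition filter_ok :: "kds_background \<Rightarrow> param set \<Rightarrow> signal_filter \<Rightarrow> bool" where
  "filter_ok B K Fl \<longleftrightarrow> 0 \<le> reg Fl \<and>
     compact (K_supp Fl) \<and> (\<forall>p\<in>K. K_supp Fl \<subseteq> X_phys B p) \<and>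
     smooth_on UNIV (switch Fl) \<and> (\<forall>t\<le>0. switch Fl t = 0) \<and> (\<forall>t\<ge>1. switch Fl t = 1) \<and>
     (\<forall>p\<in>K. test_fun (X_phys B p) (chi Fl)) \<and>
     (\<forall>p\<in>K. \<exists>S \<Omega>. closed S \<and> open \<Omega> \<and> S \<subseteq> \<Omega> \<and> (\<forall>x\<in>\<Omega>. chi Fl x = 1) \<and>
        (\<forall>d\<in>data_space B Fl p (reg Fl). \<forall>\<phi>\<in>tests B p.
           closure {x. \<phi> x \<noteq> 0} \<inter> S = {} \<longrightarrow> (\<forall>t\<in>{0<..<1}. forcing B Fl p d \<phi> t = 0))) \<and>
     (\<forall>\<sigma>. test_fun {y. 0 < fst y \<and> fst y < pi \<and>
                        0 < (case \<sigma> of Plus \<Rightarrow> 1 | Minus \<Rightarrow> -1) * snd (snd y)} (symb Fl \<sigma>)) \<and>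
     (\<forall>\<sigma>. \<forall>\<^sub>F y in nhds (pi / 2, 0, (case \<sigma> of Plus \<Rightarrow> 1 | Minus \<Rightarrow> -1)). symb Fl \<sigma> y = 1) \<and>
     (\<forall>y. symb Fl Plus y * symb Fl Minus y = 0) \<and>
     smooth_on UNIV (chart_cut Fl) \<and> closure {\<theta>. chart_cut Fl \<theta> \<noteq> 0} \<subseteq> {0<..<pi} \<and>
     (\<forall>\<sigma>. \<forall>y\<in>closure {y. symb Fl \<sigma> y \<noteq> 0}. \<forall>\<^sub>F \<theta> in nhds (fst y). chart_cut Fl \<theta> = 1)"

definition Pi_proj :: "int \<Rightarrow> field \<Rightarrow> field" where
  "Pi_proj k v x = complex_of_real (1 / (2 * pi)) *
     (LINT \<tau>:{0..2 * pi}|lebesgue. exp (- \<i> * of_int k * complex_of_real \<tau>) * v (rot \<tau> x))"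

text \<open>\<open>I\<^sub>r \<otimes> Op\<^sub>h(a\<^sub>\<plusminus>)\<close> on functions of the azimuthal sector \<open>k\<close>: left quantization in the chart
  \<open>(\<theta>, \<phi>\<^sub>*)\<close> of the sphere.  As the symbol does not depend on \<open>\<phi>\<^sub>*\<close>, the operator acts on
  \<open>e\<^bsup>ik\<phi>\<^esup> v(\<theta>)\<close> by the quantization in \<open>\<theta>\<close> of the symbol frozen at \<open>\<eta>\<^sub>\<phi> = h k\<close>.\<close>

definition A_op :: "signal_filter \<Rightarrow> pm \<Rightarrow> real \<Rightarrow> int \<Rightarrow> field \<Rightarrow> field" where
  "A_op Fl \<sigma> h k v x = complex_of_real (1 / (2 * pi * h)) *
     (LINT \<eta>|lebesgue. (LINT \<theta>':{0..pi}|lebesgue.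
        exp (\<i> * complex_of_real ((colat x - \<theta>') * \<eta> / h)) * symb Fl \<sigma> (colat x, \<eta>, h * of_int k)
        * complex_of_real (chart_cut Fl \<theta>') * v (sph (norm x) \<theta>' (azim x))))"

definition g_weight :: "nat \<Rightarrow> poles \<Rightarrow> pm \<Rightarrow> nat \<Rightarrow> param \<Rightarrow> complex \<Rightarrow> complex" where
  "g_weight n Ws \<sigma> l p \<omega> = (\<omega> / Ws n \<sigma> l p) ^ (n + 2) *
     (\<Prod>j<n. (\<omega> - Ws j \<sigma> l p) / (Ws n \<sigma> l p - Ws j \<sigma> l p))"

text \<open>\<open>v\<close> is the refined signal at time \<open>t\<close>; the contour integral over \<open>Im \<omega> = C\<close>
  (any large \<open>C\<close>) is taken in the weak sense.\<close>

definition is_refined_signal ::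
  "kds_background \<Rightarrow> signal_filter \<Rightarrow> nat \<Rightarrow> poles \<Rightarrow> param \<Rightarrow> pm \<Rightarrow> nat \<Rightarrow> data \<Rightarrow> real \<Rightarrow> field \<Rightarrow> bool"
  where
  "is_refined_signal B Fl n Ws p \<sigma> l d t v \<longleftrightarrow>
     sobolev (X_slice B p) (reg Fl + 1) v \<and>
     (\<exists>C0. \<forall>C\<ge>C0. \<forall>\<phi>\<in>tests B p.
       (let k = azimuthal \<sigma> l;
            I = (\<lambda>\<xi>::real. let \<omega> = Complex \<xi> C in
              exp (- \<i> * \<omega> * complex_of_real t) * g_weight n Ws \<sigma> l p \<omega> *
              integral\<^sup>L (lebesgue_on (X_slice B p))
                (\<lambda>x. chi Fl x * A_op Fl \<sigma> (1 / real l) k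
                       (Pi_proj k (resolvent B (reg Fl) p \<omega> (forcing_hat B Fl p d \<omega>))) x * \<phi> x))
        in integrable lebesgue I \<and>
           integral\<^sup>L (lebesgue_on (X_slice B p)) (\<lambda>x. v x * \<phi> x)
             = complex_of_real (1 / (2 * pi)) * integral\<^sup>L lebesgue I))"

definition refined_signal ::
  "kds_background \<Rightarrow> signal_filter \<Rightarrow> nat \<Rightarrow> poles \<Rightarrow> param \<Rightarrow> pm \<Rightarrow> nat \<Rightarrow> data \<Rightarrow> real \<Rightarrow> field" where
  "refined_signal B Fl n Ws p \<sigma> l d t = (SOME v. is_refined_signal B Fl n Ws p \<sigma> l d t v)"


section \<open>Two-mode model with tail control\<close>

text \<open>\<open>Amp p \<sigma> l d\<close> is the mode amplitude \<open>A\<^sub>\<plusminus>\<^sub>,\<^sub>l\<close> as a function of the data; the remainder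
  \<open>E\<close> is what is left of the signal after removing the mode.\<close>

type_synonym amplitudes = "param \<Rightarrow> pm \<Rightarrow> nat \<Rightarrow> data \<Rightarrow> field"

definition remainder ::
  "kds_background \<Rightarrow> signal_filter \<Rightarrow> nat \<Rightarrow> poles \<Rightarrow> poles \<Rightarrow> amplitudes \<Rightarrow>
     param \<Rightarrow> pm \<Rightarrow> nat \<Rightarrow> data \<Rightarrow> real \<Rightarrow> field" where
  "remainder B Fl n Ws W Amp p \<sigma> l d t =
     (\<lambda>x. refined_signal B Fl n Ws p \<sigma> l d t x
          - exp (- \<i> * W n \<sigma> l p * complex_of_real t) * Amp p \<sigma> l d x)"

definition two_mode_model ::
  "kds_background \<Rightarrow> signal_filter \<Rightarrow> param set \<Rightarrow> nat \<Rightarrow> nat \<Rightarrow> poles \<Rightarrow> poles \<Rightarrow> amplitudes \<Rightarrow>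
     real \<Rightarrow> (nat \<Rightarrow> nat \<Rightarrow> real) \<Rightarrow> (nat \<Rightarrow> nat \<Rightarrow> nat) \<Rightarrow> bool" where
  "two_mode_model B Fl K n l1 Ws W Amp \<nu> Cst Nloss \<longleftrightarrow>
     separating_line B (reg Fl) K n l1 W \<nu> \<and>
     (\<forall>m N'. 0 < Cst m N' \<and>
       (\<forall>p\<in>K. \<forall>\<sigma>. \<forall>l\<ge>l1.
          let X = X_slice B p; s' = reg Fl + real m + real (Nloss m N');
              D = data_space B Fl p s' in
          (\<forall>d\<in>D. \<forall>d'\<in>D. \<forall>c. AE x in lebesgue_on X.
             Amp p \<sigma> l (\<lambda>x. c * fst d x + fst d' x, \<lambda>x. c * snd d x + snd d' x) x
               = c * Amp p \<sigma> l d x + Amp p \<sigma> l d' x) \<and>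
          (\<forall>d\<in>D. sobolev X (reg Fl + 1) (Amp p \<sigma> l d) \<and>
             (\<forall>t\<ge>1. (\<exists>v. is_refined_signal B Fl n Ws p \<sigma> l d t v) \<and>
                sobolev X (reg Fl + 1) (remainder B Fl n Ws W Amp p \<sigma> l d t) \<and>
                sobolev_norm X (reg Fl + 1) (remainder B Fl n Ws W Amp p \<sigma> l d t)
                  \<le> Cst m N' * (exp (- \<nu> * t) / (1 + t) ^ m + 1 / real l ^ N')
                      * energy_norm X s' d))))"


section \<open>Weighted window norms and frequency extraction\<close>

definition winner :: "real \<Rightarrow> real \<Rightarrow> real \<Rightarrow> (real \<Rightarrow> real) \<Rightarrow>
    (real \<Rightarrow> complex) \<Rightarrow> (real \<Rightarrow> complex) \<Rightarrow> complex" where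
  "winner T0 T \<Delta> w f g =
     (LINT t:{T0..T0 + T - \<Delta>}|lebesgue. complex_of_real (w t) * f t * cnj (g t))"

definition wnorm :: "real \<Rightarrow> real \<Rightarrow> real \<Rightarrow> (real \<Rightarrow> real) \<Rightarrow> (real \<Rightarrow> complex) \<Rightarrow> real" where
  "wnorm T0 T \<Delta> w f = sqrt (Re (winner T0 T \<Delta> w f f))"

definition shift :: "real \<Rightarrow> (real \<Rightarrow> complex) \<Rightarrow> real \<Rightarrow> complex" where
  "shift \<Delta> f t = f (t + \<Delta>)"

definition rel_size :: "real \<Rightarrow> real \<Rightarrow> real \<Rightarrow> (real \<Rightarrow> real) \<Rightarrow>
    (real \<Rightarrow> complex) \<Rightarrow> (real \<Rightarrow> complex) \<Rightarrow> real" where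
  "rel_size T0 T \<Delta> w r y =
     max (wnorm T0 T \<Delta> w r) (wnorm T0 T \<Delta> w (shift \<Delta> r)) / wnorm T0 T \<Delta> w y"

definition window_weight :: "real \<Rightarrow> real \<Rightarrow> real \<Rightarrow> (real \<Rightarrow> real) \<Rightarrow> bool" where
  "window_weight T0 T \<Delta> w \<longleftrightarrow>
     w \<in> borel_measurable (lebesgue_on {T0..T0 + T - \<Delta>}) \<and>
     (\<forall>t\<in>{T0..T0 + T - \<Delta>}. 0 \<le> w t \<and> w t \<le> 1) \<and>
     (\<forall>t\<in>{T0 + \<Delta>..T0 + T - 2 * \<Delta>}. w t = 1)"

definition z_hat :: "real \<Rightarrow> real \<Rightarrow> real \<Rightarrow> (real \<Rightarrow> real) \<Rightarrow> (real \<Rightarrow> complex) \<Rightarrow> complex" where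
  "z_hat T0 T \<Delta> w y = winner T0 T \<Delta> w (shift \<Delta> y) y / winner T0 T \<Delta> w y y"

definition mode_factor :: "real \<Rightarrow> complex \<Rightarrow> complex" where
  "mode_factor \<Delta> \<omega> = exp (- \<i> * \<omega> * complex_of_real \<Delta>)"

text \<open>Frequency read off from \<open>\<zeta>\<close>, with the branch of the logarithm adapted to the prior \<open>\<omega>s\<close>.\<close>

definition freq_of :: "real \<Rightarrow> complex \<Rightarrow> complex \<Rightarrow> complex" where
  "freq_of \<Delta> \<omega>s \<zeta> = \<i> / complex_of_real \<Delta> *
     (Ln (\<zeta> / mode_factor \<Delta> \<omega>s) - \<i> * \<omega>s * complex_of_real \<Delta>)"

definition frequency_extraction ::
  "real \<Rightarrow> complex \<Rightarrow> complex \<Rightarrow> complex \<Rightarrow> real \<Rightarrow> bool" where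
  "frequency_extraction \<Delta> \<omega> \<omega>s zh \<epsilon> \<longleftrightarrow>
     (let z = mode_factor \<Delta> \<omega>; zs = mode_factor \<Delta> \<omega>s in
      cmod (z - zs) \<le> cmod zs / 4 \<and> cmod (zh - z) \<le> cmod z / 2 \<and>
      (\<epsilon> \<le> min (1 / 8) (cmod z / 20) \<longrightarrow>
         cmod (freq_of \<Delta> \<omega>s zh - \<omega>) \<le> 10 / (\<Delta> * cmod z) * \<epsilon>))"


section \<open>The inverse map\<close>

definition freq_map :: "nat \<Rightarrow> complex \<Rightarrow> complex \<Rightarrow> real \<times> real" where
  "freq_map l \<omega>p \<omega>m = (Re ((\<omega>p + \<omega>m) / (2 * of_nat l)), Re ((\<omega>p - \<omega>m) / (2 * of_nat l)))"

definition G_map :: "nat \<Rightarrow> poles \<Rightarrow> nat \<Rightarrow> param \<Rightarrow> real \<times> real" where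
  "G_map n W l p = freq_map l (W n Plus l p) (W n Minus l p)"

definition real_analytic_on :: "(param \<Rightarrow> real \<times> real) \<Rightarrow> param set \<Rightarrow> bool" where
  "real_analytic_on f U \<longleftrightarrow> (\<forall>p\<in>U. \<exists>r>0. \<exists>c. \<forall>q\<in>ball p r.
     ((\<lambda>(i, j). ((fst q - fst p) ^ i * (snd q - snd p) ^ j) *\<^sub>R c i j) has_sum f q) UNIV)"

definition jacobian :: "(param \<Rightarrow> real \<times> real) \<Rightarrow> param \<Rightarrow> real" where
  "jacobian f p = (let D = frechet_derivative f (at p) in
     fst (D (1, 0)) * snd (D (0, 1)) - fst (D (0, 1)) * snd (D (1, 0)))"

text \<open>Real-analyticity on the compact set \<open>K\<close> means the existence of a real-analytic extension
  \<open>g\<close> to an open neighbourhood.  In the stability estimate, \<open>rst l\<close> is the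
  distance below which two points of \<open>K\<close> are sufficiently close.\<close>

definition inverse_map ::
  "param set \<Rightarrow> nat \<Rightarrow> nat \<Rightarrow> poles \<Rightarrow> real \<Rightarrow> (nat \<Rightarrow> real) \<Rightarrow> bool" where
  "inverse_map K n l0 W Cstar rst \<longleftrightarrow> 0 < Cstar \<and>
     (\<exists>c>0. \<forall>l\<ge>l0. \<exists>U g. open U \<and> K \<subseteq> U \<and> real_analytic_on g U \<and>
        (\<forall>p\<in>K. g p = G_map n W l p \<and> c \<le> \<bar>jacobian g p\<bar> \<and>
           (\<exists>O' h. open O' \<and> p \<in> O' \<and> O' \<subseteq> U \<and> open (g ` O') \<and> homeomorphism O' (g ` O') g h))) \<and>
     (\<forall>l\<ge>l0. 0 < rst l \<and>
        (\<forall>p\<in>K. \<forall>p'\<in>K. dist p p' < rst l \<longrightarrow>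
           norm (p - p') \<le> Cstar * norm (G_map n W l p - G_map n W l p')))"

end

theory Submission
  imports Defs
begin

text \<open>The frequency bound (A3) for both signals passes through the linear map
  \<open>freq_map\<close>, which has norm \<open>1 / (\<surd>2 l)\<close>, and then through the Lipschitz bound for the inverse
  of \<open>G_map\<close>; the splitting of \<open>\<epsilon>\<close> is Minkowski's inequality for the weighted norm.  The explicit
  tail bounds compare the weighted norm of \<open>\<rho>\<close> from above with the unweighted norm of its pointwise
  majorant, and that of the pure mode from below with its restriction to the part of the window where
  \<open>w = 1\<close>.\<close>

section \<open>Weighted norms\<close>

lemma wnorm_eq:
  "wnorm T0 T \<Delta> w f = sqrt (LINT t:{T0..T0 + T - \<Delta>}|lebesgue. w t * (cmod (f t))\<^sup>2)"
proof -
  have "complex_of_real (w t) * f t * cnj (f t) = complex_of_real (w t * (cmod (f t))\<^sup>2)" for t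
    by (simp only: mult.assoc complex_norm_square[symmetric] of_real_mult)
  then show ?thesis
    unfolding wnorm_def winner_def by (simp only: set_integral_complex_of_real Re_complex_of_real)
qed

lemma wnorm_nonneg:
  assumes "window_weight T0 T \<Delta> w"
  shows "0 \<le> wnorm T0 T \<Delta> w f"
  unfolding wnorm_eq set_lebesgue_integral_def using assms
  by (auto simp: window_weight_def indicator_def intro!: Bochner_Integration.integral_nonneg)

text \<open>The difference of the two sides is the square \<open>(s * a - b)\<^sup>2 / s\<close>. It
  vanishes at \<open>s = b / a\<close>, the value approached when the parameter is
  optimized.\<close>

lemma add_sq_le_weighted:
  fixes a b s :: real
  assumes "0 < s"
  shows "(a + b)\<^sup>2 \<le> (1 + s) * a\<^sup>2 + (1 + 1 / s) * b\<^sup>2"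
proof -
  have "(1 + s) * a\<^sup>2 + (1 + 1 / s) * b\<^sup>2 - (a + b)\<^sup>2 = (s * a - b)\<^sup>2 / s"
    using assms by (simp add: field_simps power2_eq_square)
  then show ?thesis
    using assms by (smt (verit) divide_nonneg_pos zero_le_power2)
qed

text \<open>Minkowski's inequality for L2 with density \<open>w\<close>. Integrating a pointwise
  Young inequality and optimizing its parameter replaces Cauchy-Schwarz, so the product of
  \<open>f\<close> and \<open>g\<close> never has to be shown integrable.\<close>

lemma wnorm_triangle:
  assumes w: "\<And>t. t \<in> {T0..T0 + T - \<Delta>} \<Longrightarrow> 0 \<le> w t"
    and f: "set_integrable lebesgue {T0..T0 + T - \<Delta>} (\<lambda>t. w t * (cmod (f t))\<^sup>2)"
    and g: "set_integrable lebesgue {T0..T0 + T - \<Delta>} (\<lambda>t. w t * (cmod (g t))\<^sup>2)"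
  shows "wnorm T0 T \<Delta> w (\<lambda>t. f t + g t) \<le> wnorm T0 T \<Delta> w f + wnorm T0 T \<Delta> w g"
proof -
  define I where "I = {T0..T0 + T - \<Delta>}"
  define N where "N h = (LINT t:I|lebesgue. w t * (cmod (h t))\<^sup>2)" for h :: "real \<Rightarrow> complex"
  define a where "a = sqrt (N f)"
  define b where "b = sqrt (N g)"
  have N_nonneg: "0 \<le> N h" for h
    unfolding N_def set_lebesgue_integral_def using w
    by (intro Bochner_Integration.integral_nonneg) (auto simp: I_def indicator_def)
  have ab: "0 \<le> a" "0 \<le> b" "a\<^sup>2 = N f" "b\<^sup>2 = N g"
    by (simp_all add: a_def b_def N_nonneg)
  \<comment> \<open>Young's inequality with a parameter, so that neither norm has to be nonzero\<close>
  have young: "N (\<lambda>t. f t + g t) \<le> (1 + s) * a\<^sup>2 + (1 + 1 / s) * b\<^sup>2" if s: "0 < s" for s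
  proof -
    have int: "set_integrable lebesgue I (\<lambda>t. (1 + s) * (w t * (cmod (f t))\<^sup>2))"
      "set_integrable lebesgue I (\<lambda>t. (1 + 1 / s) * (w t * (cmod (g t))\<^sup>2))"
      using f g by (auto simp: I_def intro!: set_integrable_mult_right)
    have "N (\<lambda>t. f t + g t) \<le> (LINT t:I|lebesgue. (1 + s) * (w t * (cmod (f t))\<^sup>2)
            + (1 + 1 / s) * (w t * (cmod (g t))\<^sup>2))"
      unfolding N_def set_lebesgue_integral_def
    proof (rule integral_mono')
      show "integrable lebesgue (\<lambda>t. indicator I t *\<^sub>R ((1 + s) * (w t * (cmod (f t))\<^sup>2)
              + (1 + 1 / s) * (w t * (cmod (g t))\<^sup>2)))"
        using set_integral_add(1)[OF int] by (simp only: set_integrable_def)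
      fix t :: real
      show "0 \<le> indicator I t *\<^sub>R ((1 + s) * (w t * (cmod (f t))\<^sup>2)
              + (1 + 1 / s) * (w t * (cmod (g t))\<^sup>2))"
        using w s by (auto simp: I_def indicator_def)
      show "indicator I t *\<^sub>R (w t * (cmod (f t + g t))\<^sup>2)
          \<le> indicator I t *\<^sub>R ((1 + s) * (w t * (cmod (f t))\<^sup>2)
              + (1 + 1 / s) * (w t * (cmod (g t))\<^sup>2))"
      proof (cases "t \<in> I")
        case True
        have "(cmod (f t + g t))\<^sup>2 \<le> (cmod (f t) + cmod (g t))\<^sup>2"
          by (intro power_mono norm_triangle_ineq) auto
        also have "\<dots> \<le> (1 + s) * (cmod (f t))\<^sup>2 + (1 + 1 / s) * (cmod (g t))\<^sup>2"
          by (rule add_sq_le_weighted[OF s])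
        finally have "w t * (cmod (f t + g t))\<^sup>2
            \<le> w t * ((1 + s) * (cmod (f t))\<^sup>2 + (1 + 1 / s) * (cmod (g t))\<^sup>2)"
          using w[of t] True by (intro mult_left_mono) (auto simp: I_def)
        with True show ?thesis by (simp add: algebra_simps)
      qed simp
    qed
    also have "\<dots> = (1 + s) * N f + (1 + 1 / s) * N g"
      by (subst set_integral_add(2)[OF int]) (simp only: N_def set_integral_mult_right)
    finally show ?thesis by (simp add: ab)
  qed
  have "N (\<lambda>t. f t + g t) \<le> (a + b)\<^sup>2 + e" if e: "0 < e" for e
  proof -
    \<comment> \<open>The optimal parameter \<open>b / a\<close> is perturbed by \<open>d\<close> so
      that it stays positive when \<open>a\<close> or \<open>b\<close> is 0. The cost is
      \<open>d * (a + b)\<close>, which this choice keeps below \<open>e\<close>; the extra 1 covers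
      \<open>a = b = 0\<close>.\<close>
    define d where "d = e / (a + b + 1)"
    have d: "0 < d" using e ab by (simp add: d_def add_nonneg_pos)
    define s where "s = (b + d) / (a + d)"
    have s: "0 < s" using d ab by (simp add: s_def add_nonneg_pos)
    have "s * a\<^sup>2 = (b + d) * (a * (a / (a + d)))" by (simp add: s_def power2_eq_square)
    also have "\<dots> \<le> (b + d) * (a * 1)"
      using d ab by (intro mult_left_mono) (auto simp: divide_le_eq_1)
    finally have 1: "s * a\<^sup>2 \<le> (b + d) * a" by simp
    have "1 / s * b\<^sup>2 = (a + d) * (b * (b / (b + d)))" by (simp add: s_def power2_eq_square)
    also have "\<dots> \<le> (a + d) * (b * 1)"
      using d ab by (intro mult_left_mono) (auto simp: divide_le_eq_1)
    finally have 2: "1 / s * b\<^sup>2 \<le> (a + d) * b" by simp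
    have "N (\<lambda>t. f t + g t) \<le> a\<^sup>2 + b\<^sup>2 + (b + d) * a + (a + d) * b"
      using young[OF s] 1 2 by (simp add: algebra_simps)
    also have "\<dots> = (a + b)\<^sup>2 + d * (a + b)" by (simp add: power2_eq_square algebra_simps)
    also have "d * (a + b) \<le> d * (a + b + 1)" using d by (intro mult_left_mono) auto
    also have "\<dots> = e" using ab by (simp add: d_def add_nonneg_eq_0_iff)
    finally show ?thesis by simp
  qed
  then have "N (\<lambda>t. f t + g t) \<le> (a + b)\<^sup>2" by (rule field_le_epsilon)
  then have "sqrt (N (\<lambda>t. f t + g t)) \<le> a + b" using ab by (simp add: real_le_lsqrt N_nonneg)
  then show ?thesis by (simp add: wnorm_eq a_def b_def N_def I_def)
qed

lemma wnorm_le_L2: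
  assumes w: "window_weight T0 T \<Delta> w" and S: "{T0..T0 + T - \<Delta>} \<subseteq> S"
    and S_meas: "S \<in> sets lebesgue" and f: "set_integrable lebesgue S (\<lambda>t. (cmod (f t))\<^sup>2)"
  shows "set_integrable lebesgue {T0..T0 + T - \<Delta>} (\<lambda>t. w t * (cmod (f t))\<^sup>2)"
    and "wnorm T0 T \<Delta> w f \<le> sqrt (LINT t:S|lebesgue. (cmod (f t))\<^sup>2)"
proof -
  define I where "I = {T0..T0 + T - \<Delta>}"
  have I: "I \<in> sets lebesgue" by (simp add: I_def)
  have fI: "set_integrable lebesgue I (\<lambda>t. (cmod (f t))\<^sup>2)"
    using set_integrable_subset[OF f I] S by (simp add: I_def)
  have w01: "0 \<le> w t" "w t \<le> 1" if "t \<in> I" for t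
    using w that by (auto simp: window_weight_def I_def)
  have wm: "(\<lambda>t. indicator I t *\<^sub>R w t) \<in> borel_measurable lebesgue"
    using w I by (simp add: window_weight_def I_def borel_measurable_restrict_space_iff)
  \<comment> \<open>Measurability of \<open>w\<close> is given only on the window, so the weighted
    integrand is written as a product of two extensions by zero; the squared indicator then
    collapses.\<close>
  have "(\<lambda>t. (indicator I t *\<^sub>R w t) * (indicator I t *\<^sub>R (cmod (f t))\<^sup>2)) \<in> borel_measurable lebesgue"
    using fI by (intro borel_measurable_times wm) (auto simp: set_integrable_def)
  also have "(\<lambda>t. (indicator I t *\<^sub>R w t) * (indicator I t *\<^sub>R (cmod (f t))\<^sup>2))
      = (\<lambda>t. indicator I t *\<^sub>R (w t * (cmod (f t))\<^sup>2))"
    by (auto simp: indicator_def)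
  finally have meas: "set_borel_measurable lebesgue I (\<lambda>t. w t * (cmod (f t))\<^sup>2)"
    by (simp add: set_borel_measurable_def)
  have le: "w t * (cmod (f t))\<^sup>2 \<le> (cmod (f t))\<^sup>2" if "t \<in> I" for t
    using mult_right_mono[OF w01(2)[OF that], of "(cmod (f t))\<^sup>2"] by simp
  show int: "set_integrable lebesgue {T0..T0 + T - \<Delta>} (\<lambda>t. w t * (cmod (f t))\<^sup>2)"
    using set_integrable_bound[OF fI meas] le w01 by (auto simp: I_def)
  have "(LINT t:I|lebesgue. w t * (cmod (f t))\<^sup>2) \<le> (LINT t:S|lebesgue. (cmod (f t))\<^sup>2)"
    unfolding set_lebesgue_integral_def
  proof (rule integral_mono')
    show "integrable lebesgue (\<lambda>t. indicator S t *\<^sub>R (cmod (f t))\<^sup>2)"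
      using f by (simp add: set_integrable_def)
    show "indicator I t *\<^sub>R (w t * (cmod (f t))\<^sup>2) \<le> indicator S t *\<^sub>R (cmod (f t))\<^sup>2" for t
      using le[of t] S by (auto simp: I_def indicator_def)
  qed simp
  then show "wnorm T0 T \<Delta> w f \<le> sqrt (LINT t:S|lebesgue. (cmod (f t))\<^sup>2)"
    by (simp add: wnorm_eq I_def)
qed

text \<open>Translation invariance of Lebesgue measure, taken as the affine change of variables of
  slope 1; hence the form \<open>c + 1 * t\<close> in the proof.\<close>

lemma set_integral_shift:
  fixes f :: "real \<Rightarrow> real"
  assumes "set_integrable lebesgue {a..b} f"
  shows "set_integrable lebesgue {a - c..b - c} (\<lambda>t. f (t + c))"
    and "(LINT t:{a - c..b - c}|lebesgue. f (t + c)) = (LINT t:{a..b}|lebesgue. f t)"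
proof -
  have ind: "indicator {a - c..b - c} t = (indicator {a..b} (c + 1 * t) :: real)" for t
    by (auto simp: indicator_def)
  show "set_integrable lebesgue {a - c..b - c} (\<lambda>t. f (t + c))"
    using lebesgue_integrable_real_affine[of "\<lambda>t. indicator {a..b} t *\<^sub>R f t" 1 c] assms
    by (simp only: set_integrable_def ind) (simp add: add.commute)
  show "(LINT t:{a - c..b - c}|lebesgue. f (t + c)) = (LINT t:{a..b}|lebesgue. f t)"
    using lebesgue_integral_real_affine[of 1 "\<lambda>t. indicator {a..b} t *\<^sub>R f t" c]
    by (simp only: set_lebesgue_integral_def ind) (simp add: add.commute)
qed

text \<open>Both norms see \<open>f\<close> only on parts of the observation window, since the shift
  moves the integration domain to \<open>{T0 + \<Delta>..T0 + T}\<close>. The two integrability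
  claims are what Minkowski's inequality requires.\<close>

lemma wnorm_window:
  assumes w: "window_weight T0 T \<Delta> w" and "0 \<le> \<Delta>"
    and f: "L2_on {T0..T0 + T} f"
  shows "set_integrable lebesgue {T0..T0 + T - \<Delta>} (\<lambda>t. w t * (cmod (f t))\<^sup>2)"
    and "set_integrable lebesgue {T0..T0 + T - \<Delta>} (\<lambda>t. w t * (cmod (shift \<Delta> f t))\<^sup>2)"
    and "max (wnorm T0 T \<Delta> w f) (wnorm T0 T \<Delta> w (shift \<Delta> f))
           \<le> sqrt (LINT t:{T0..T0 + T}|lebesgue. (cmod (f t))\<^sup>2)"
proof -
  have int: "set_integrable lebesgue {T0..T0 + T} (\<lambda>t. (cmod (f t))\<^sup>2)"
    using f by (simp add: L2_on_def set_integrable_def integrable_restrict_space)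
  note shifted = set_integral_shift[OF int, of \<Delta>, folded shift_def]
  have sub: "{T0..T0 + T - \<Delta>} \<subseteq> {T0..T0 + T}" "{T0..T0 + T - \<Delta>} \<subseteq> {T0 - \<Delta>..T0 + T - \<Delta>}"
    using \<open>0 \<le> \<Delta>\<close> by auto
  show "set_integrable lebesgue {T0..T0 + T - \<Delta>} (\<lambda>t. w t * (cmod (f t))\<^sup>2)"
    by (rule wnorm_le_L2(1)[OF w sub(1) _ int]) simp
  show "set_integrable lebesgue {T0..T0 + T - \<Delta>} (\<lambda>t. w t * (cmod (shift \<Delta> f t))\<^sup>2)"
    by (rule wnorm_le_L2(1)[OF w sub(2) _ shifted(1)]) simp
  show "max (wnorm T0 T \<Delta> w f) (wnorm T0 T \<Delta> w (shift \<Delta> f))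
      \<le> sqrt (LINT t:{T0..T0 + T}|lebesgue. (cmod (f t))\<^sup>2)"
    using wnorm_le_L2(2)[OF w sub(1) _ int] wnorm_le_L2(2)[OF w sub(2) _ shifted(1)] shifted(2)
    by simp
qed

text \<open>Minkowski's inequality for the signals and for their shifts, followed by subadditivity
  of the maximum.\<close>

lemma rel_size_triangle:
  assumes w: "window_weight T0 T \<Delta> w" and \<Delta>: "0 \<le> \<Delta>"
    and f: "L2_on {T0..T0 + T} f" and g: "L2_on {T0..T0 + T} g"
  shows "rel_size T0 T \<Delta> w (\<lambda>t. f t + g t) y \<le> rel_size T0 T \<Delta> w f y + rel_size T0 T \<Delta> w g y"
proof -
  have w0: "0 \<le> w t" if "t \<in> {T0..T0 + T - \<Delta>}" for t
    using w that by (auto simp: window_weight_def)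
  have "wnorm T0 T \<Delta> w (\<lambda>t. f t + g t) \<le> wnorm T0 T \<Delta> w f + wnorm T0 T \<Delta> w g"
    by (rule wnorm_triangle[OF w0 wnorm_window(1)[OF w \<Delta> f] wnorm_window(1)[OF w \<Delta> g]])
  moreover have "wnorm T0 T \<Delta> w (shift \<Delta> (\<lambda>t. f t + g t))
      \<le> wnorm T0 T \<Delta> w (shift \<Delta> f) + wnorm T0 T \<Delta> w (shift \<Delta> g)"
    using wnorm_triangle[OF w0 wnorm_window(2)[OF w \<Delta> f] wnorm_window(2)[OF w \<Delta> g]]
    by (simp add: shift_def[abs_def])
  ultimately have "max (wnorm T0 T \<Delta> w (\<lambda>t. f t + g t)) (wnorm T0 T \<Delta> w (shift \<Delta> (\<lambda>t. f t + g t)))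
      \<le> max (wnorm T0 T \<Delta> w f) (wnorm T0 T \<Delta> w (shift \<Delta> f))
        + max (wnorm T0 T \<Delta> w g) (wnorm T0 T \<Delta> w (shift \<Delta> g))"
    by linarith
  then show ?thesis
    unfolding rel_size_def add_divide_distrib[symmetric]
    by (rule divide_right_mono) (rule wnorm_nonneg[OF w])
qed

text \<open>A continuous majorant on a compact interval is square integrable, and domination passes
  this on to the measurable \<open>f\<close>. This converts the pointwise tail estimate into an L2
  estimate.\<close>

lemma L2_on_bounded:
  fixes f :: "real \<Rightarrow> complex" and g :: "real \<Rightarrow> real"
  assumes f: "f \<in> borel_measurable (lebesgue_on {a..b})" and g: "continuous_on {a..b} g"
    and le: "\<And>t. t \<in> {a..b} \<Longrightarrow> cmod (f t) \<le> g t"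
  shows "L2_on {a..b} f"
    and "(LINT t:{a..b}|lebesgue. (cmod (f t))\<^sup>2) \<le> (LINT t:{a..b}|lebesgue. (g t)\<^sup>2)"
proof -
  have gi: "set_integrable lebesgue {a..b} (\<lambda>t. (g t)\<^sup>2)"
    by (intro absolutely_integrable_continuous_real continuous_intros g)
  have le2: "(cmod (f t))\<^sup>2 \<le> (g t)\<^sup>2" if "t \<in> {a..b}" for t
    using le[OF that] by (intro power_mono) auto
  have "(\<lambda>t. (cmod (f t))\<^sup>2) \<in> borel_measurable (lebesgue_on {a..b})"
    using f by measurable
  then have "set_borel_measurable lebesgue {a..b} (\<lambda>t. (cmod (f t))\<^sup>2)"
    by (simp add: set_borel_measurable_def borel_measurable_restrict_space_iff)
  then have fi: "set_integrable lebesgue {a..b} (\<lambda>t. (cmod (f t))\<^sup>2)"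
    by (rule set_integrable_bound[OF gi]) (use le2 in auto)
  then show "L2_on {a..b} f"
    using f by (simp add: L2_on_def set_integrable_def integrable_restrict_space)
  show "(LINT t:{a..b}|lebesgue. (cmod (f t))\<^sup>2) \<le> (LINT t:{a..b}|lebesgue. (g t)\<^sup>2)"
    using fi gi le2 by (rule set_integral_mono)
qed

text \<open>The modulus of the oscillating factor is \<open>exp (Im \<omega> * t)\<close>. The
  result is the denominator of every relative size.\<close>

lemma wnorm_mode:
  "wnorm T0 T \<Delta> w (\<lambda>t. a * exp (- \<i> * \<omega> * complex_of_real t))
     = cmod a * sqrt (LINT t:{T0..T0 + T - \<Delta>}|lebesgue. w t * exp (2 * Im \<omega> * t))"
proof -
  have "w t * (cmod (a * exp (- \<i> * \<omega> * complex_of_real t)))\<^sup>2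
      = (cmod a)\<^sup>2 * (w t * exp (2 * Im \<omega> * t))" for t
    by (simp add: norm_mult power_mult_distrib exp_double[symmetric])
  then show ?thesis
    by (simp only: wnorm_eq set_integral_mult_right real_sqrt_mult) simp
qed

text \<open>Only the part of the window where the weight equals 1 is kept; the rest contributes a
  nonnegative amount.\<close>

lemma mode_window_lower:
  assumes w: "window_weight T0 T \<Delta> w" and \<Delta>: "0 \<le> \<Delta>" and T: "3 * \<Delta> \<le> T"
  shows "(LINT t:{T0 + \<Delta>..T0 + T - 2 * \<Delta>}|lebesgue. exp (2 * c * t))
           \<le> (LINT t:{T0..T0 + T - \<Delta>}|lebesgue. w t * exp (2 * c * t))"
proof -
  \<comment> \<open>Reading \<open>exp (2 * c * t)\<close> as the squared modulus of
    \<open>exp (c * t)\<close> makes the earlier L2 comparison yield integrability of the weighted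
    integrand.\<close>
  have "set_integrable lebesgue {T0..T0 + T - \<Delta>} (\<lambda>t. (cmod (complex_of_real (exp (c * t))))\<^sup>2)"
    by (intro absolutely_integrable_continuous_real continuous_intros)
  from wnorm_le_L2(1)[OF w order_refl _ this]
  have "set_integrable lebesgue {T0..T0 + T - \<Delta>} (\<lambda>t. w t * exp (2 * c * t))"
    by (simp add: exp_double[symmetric] mult.assoc)
  then have "integrable lebesgue (\<lambda>t. indicator {T0..T0 + T - \<Delta>} t *\<^sub>R (w t * exp (2 * c * t)))"
    by (simp only: set_integrable_def)
  then show ?thesis
    unfolding set_lebesgue_integral_def
    by (rule integral_mono') (use w \<Delta> T in \<open>auto simp: window_weight_def indicator_def\<close>)
qed

text \<open>For \<open>c \<le> 0\<close> the integrand is nonincreasing, so its minimum is attained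
  at the right endpoint.\<close>

lemma exp_integral_lower:
  fixes a b c :: real
  assumes "a \<le> b" "c \<le> 0"
  shows "(b - a) * exp (2 * c * b) \<le> (LINT t:{a..b}|lebesgue. exp (2 * c * t))"
proof -
  have "(LINT t:{a..b}|lebesgue. exp (2 * c * b)) \<le> (LINT t:{a..b}|lebesgue. exp (2 * c * t))"
  proof (rule set_integral_mono)
    show "exp (2 * c * b) \<le> exp (2 * c * t)" if "t \<in> {a..b}" for t
      using that \<open>c \<le> 0\<close> by (auto intro!: mult_left_mono_neg)
  qed (intro absolutely_integrable_continuous_real continuous_intros)+
  then show ?thesis using \<open>a \<le> b\<close> by (simp add: set_integral_const)
qed

section \<open>Detectors and the frequency map\<close>

lemma detector_norm_nonneg:
  assumes "detector X s Ob"
  shows "0 \<le> detector_norm X s Ob"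
  unfolding detector_norm_def using assms by (intro cInf_greatest) (auto simp: detector_def)

text \<open>The infimum of the admissible constants is itself admissible: if the Sobolev norm is
  positive, the quotient of \<open>cmod (Ob u)\<close> by it bounds all of them from below; if it
  vanishes, any one of them forces \<open>Ob u = 0\<close>.\<close>

lemma detector_bound:
  assumes det: "detector X s Ob" and u: "sobolev X s u"
  shows "cmod (Ob u) \<le> detector_norm X s Ob * sobolev_norm X s u"
proof (cases "sobolev_norm X s u = 0")
  case True
  with det u show ?thesis by (auto simp: detector_def)
next
  case False
  have "0 \<le> sobolev_norm X s u"
    unfolding sobolev_norm_def
    using u by (intro cInf_greatest)
      (auto simp: sobolev_def sobolev_R3_norm_def intro!: Bochner_Integration.integral_nonneg)
  with False have pos: "0 < sobolev_norm X s u" by simp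
  have "cmod (Ob u) / sobolev_norm X s u \<le> detector_norm X s Ob"
    unfolding detector_norm_def using det u pos
    by (intro cInf_greatest) (auto simp: detector_def pos_divide_le_eq)
  then show ?thesis using pos by (simp add: pos_divide_le_eq)
qed

text \<open>The factor 1 / sqrt 2 comes from \<open>(x + y)\<^sup>2 + (x - y)\<^sup>2 = 2 *
  (x\<^sup>2 + y\<^sup>2)\<close>, set against the square of \<open>2 * l\<close>, where
  \<open>x\<close> and \<open>y\<close> are the real parts of the two frequency differences.\<close>

lemma norm_freq_map_diff:
  assumes "0 < l"
  shows "norm (freq_map l p m - freq_map l p' m') \<le> (cmod (p - p') + cmod (m - m')) / (sqrt 2 * real l)"
proof -
  define x where "x = Re (p - p')"
  define y where "y = Re (m - m')"
  have "freq_map l p m - freq_map l p' m' = ((x + y) / (2 * real l), (x - y) / (2 * real l))"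
    by (simp add: freq_map_def x_def y_def diff_divide_distrib add_divide_distrib
        Re_divide_of_nat[of _ "2 * l", simplified])
  then have "(norm (freq_map l p m - freq_map l p' m'))\<^sup>2
      = ((x + y) / (2 * real l))\<^sup>2 + ((x - y) / (2 * real l))\<^sup>2"
    by (simp only: norm_Pair) (simp add: power_divide)
  also have "\<dots> = (x\<^sup>2 + y\<^sup>2) / (sqrt 2 * real l)\<^sup>2"
    using assms by (simp add: power_divide power_mult_distrib field_simps power2_eq_square)
  also have "\<dots> \<le> (cmod (p - p') + cmod (m - m'))\<^sup>2 / (sqrt 2 * real l)\<^sup>2"
  proof (rule divide_right_mono)
    have "x\<^sup>2 + y\<^sup>2 \<le> (\<bar>x\<bar> + \<bar>y\<bar>)\<^sup>2" by (simp add: power2_sum)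
    also have "\<dots> \<le> (cmod (p - p') + cmod (m - m'))\<^sup>2"
      unfolding x_def y_def by (intro power_mono add_mono abs_Re_le_cmod) auto
    finally show "x\<^sup>2 + y\<^sup>2 \<le> (cmod (p - p') + cmod (m - m'))\<^sup>2" .
  qed simp
  finally show ?thesis
    by (simp flip: power_divide add: power2_le_iff_abs_le)
qed

theorem theorem7p15:
  fixes B :: kds_background and Fl :: signal_filter and K :: "param set" and a0 :: real
    and n l0 l1 l :: nat and Ws W :: poles
    and Amp :: amplitudes and \<nu> :: real and Cst :: "nat \<Rightarrow> nat \<Rightarrow> real" and Nloss :: "nat \<Rightarrow> nat \<Rightarrow> nat"
    and Cstar :: real and rst :: "nat \<Rightarrow> real"
    and M a :: real and d :: data
    and T0 T \<Delta> :: real and w :: "real \<Rightarrow> real"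
    and Ob :: "field \<Rightarrow> complex" and \<eta> :: "pm \<Rightarrow> real \<Rightarrow> complex"
    and amp :: "pm \<Rightarrow> complex" and \<rho> y0 ym r :: "pm \<Rightarrow> real \<Rightarrow> complex"
    and z \<omega>h :: "pm \<Rightarrow> complex" and \<epsilon> \<epsilon>tail \<epsilon>meas :: "pm \<Rightarrow> real"
    and Nb :: "param set" and ph :: param and Bd :: "(pm \<Rightarrow> real) \<Rightarrow> real"
  \<comment> \<open>background, parameter set, signal construction\<close>
  assumes background: "background_ok B K"
    and K: "0 < a0" "compact K" "K \<subseteq> subextremal (Lam B) \<inter> {p. \<bar>snd p\<bar> \<le> a0}"
    and fil: "filter_ok B K Fl"
    and l: "1 \<le> l0" "1 \<le> l1" "max l0 l1 \<le> l"
    and poles: "equatorial_qnms B (reg Fl) K n (max l0 l1) Ws W"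
  \<comment> \<open>true parameters, data, detector, observation window\<close>
    and true_param: "(M, a) \<in> K"
    and data: "\<exists>m N'. d \<in> data_space B Fl (M, a) (reg Fl + real m + real (Nloss m N'))"
    and det: "detector (X_slice B (M, a)) (reg Fl + 1) Ob"
    and window: "1 \<le> T0" "0 < \<Delta>" "\<Delta> < T" "window_weight T0 T \<Delta> w"
  \<comment> \<open>measured quantities\<close>
    and amp_def: "\<And>\<sigma>. amp \<sigma> = Ob (Amp (M, a) \<sigma> l d)"
    and rho_def: "\<And>\<sigma> t. \<rho> \<sigma> t = Ob (remainder B Fl n Ws W Amp (M, a) \<sigma> l d t)"
    and y0_def: "\<And>\<sigma> t. y0 \<sigma> t = amp \<sigma> * exp (- \<i> * W n \<sigma> l (M, a) * complex_of_real t)"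
    and ym_def: "\<And>\<sigma> t. ym \<sigma> t = Ob (refined_signal B Fl n Ws (M, a) \<sigma> l d t) + \<eta> \<sigma> t"
    and r_def: "\<And>\<sigma> t. r \<sigma> t = \<rho> \<sigma> t + \<eta> \<sigma> t"
    and z_def: "\<And>\<sigma>. z \<sigma> = mode_factor \<Delta> (W n \<sigma> l (M, a))"
    and eps_def: "\<And>\<sigma>. \<epsilon> \<sigma> = rel_size T0 T \<Delta> w (r \<sigma>) (y0 \<sigma>)"
    and eps_tail_def: "\<And>\<sigma>. \<epsilon>tail \<sigma> = rel_size T0 T \<Delta> w (\<rho> \<sigma>) (y0 \<sigma>)"
    and eps_meas_def: "\<And>\<sigma>. \<epsilon>meas \<sigma> = rel_size T0 T \<Delta> w (\<eta> \<sigma>) (y0 \<sigma>)"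
    and omega_hat_def: "\<And>\<sigma>. \<omega>h \<sigma> = freq_of \<Delta> (Ws n \<sigma> l (M, a)) (z_hat T0 T \<Delta> w (ym \<sigma>))"
    and Bd_def: "\<And>e. Bd e = 5 * sqrt 2 * Cstar / (\<Delta> * real l) *
                           (e Plus / cmod (z Plus) + e Minus / cmod (z Minus))"
  \<comment> \<open>the norms and quotients above are meaningful\<close>
    and eta_L2: "\<And>\<sigma>. L2_on {T0..T0 + T} (\<eta> \<sigma>)"
    and rho_meas: "\<And>\<sigma>. \<rho> \<sigma> \<in> borel_measurable (lebesgue_on {T0..T0 + T})"
    and y0_nz: "\<And>\<sigma>. wnorm T0 T \<Delta> w (y0 \<sigma>) \<noteq> 0"
  \<comment> \<open>inputs (A1)--(A4)\<close>
    and A1: "two_mode_model B Fl K n l1 Ws W Amp \<nu> Cst Nloss"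
    and A2: "\<And>\<sigma>. amp \<sigma> \<noteq> 0"
    and A3: "\<And>\<sigma>. frequency_extraction \<Delta> (W n \<sigma> l (M, a)) (Ws n \<sigma> l (M, a))
                     (z_hat T0 T \<Delta> w (ym \<sigma>)) (\<epsilon> \<sigma>)"
    and A4: "inverse_map K n l0 W Cstar rst"
  \<comment> \<open>reconstruction by the local inverse of the frequency map near the true point\<close>
    and nbhd: "open Nb" "(M, a) \<in> Nb" "Nb \<subseteq> ball (M, a) (rst l)" "inj_on (G_map n W l) (K \<inter> Nb)"
    and in_range: "freq_map l (\<omega>h Plus) (\<omega>h Minus) \<in> G_map n W l ` (K \<inter> Nb)"
    and ph_def: "ph = the_inv_into (K \<inter> Nb) (G_map n W l) (freq_map l (\<omega>h Plus) (\<omega>h Minus))"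
    and small: "\<And>\<sigma>. \<epsilon> \<sigma> \<le> min (1 / 8) (cmod (z \<sigma>) / 20)"
  shows "norm (ph - (M, a)) \<le> Bd \<epsilon> \<and>
    (\<forall>\<sigma>. \<epsilon> \<sigma> \<le> \<epsilon>tail \<sigma> + \<epsilon>meas \<sigma>) \<and> norm (ph - (M, a)) \<le> Bd \<epsilon>tail + Bd \<epsilon>meas \<and>
    (\<forall>m N'. d \<in> data_space B Fl (M, a) (reg Fl + real m + real (Nloss m N')) \<longrightarrow>
      (let c = Cst m N' * detector_norm (X_slice B (M, a)) (reg Fl + 1) Ob
                 * energy_norm (X_slice B (M, a)) (reg Fl + real m + real (Nloss m N')) d;
           env = (\<lambda>t. exp (- \<nu> * t) / (1 + t) ^ m + 1 / real l ^ N');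
           im = (\<lambda>\<sigma>. Im (W n \<sigma> l (M, a)));
           num = c * sqrt (LINT t:{T0..T0 + T}|lebesgue. (env t)\<^sup>2);
           b1 = (\<lambda>\<sigma>. num / (cmod (amp \<sigma>) *
                  sqrt (LINT t:{T0..T0 + T - \<Delta>}|lebesgue. w t * exp (2 * im \<sigma> * t))));
           b2 = (\<lambda>\<sigma>. num / (cmod (amp \<sigma>) *
                  sqrt (LINT t:{T0 + \<Delta>..T0 + T - 2 * \<Delta>}|lebesgue. exp (2 * im \<sigma> * t))));
           b3 = (\<lambda>\<sigma>. c * sqrt T * env T0 / (cmod (amp \<sigma>) *
                  (exp (im \<sigma> * (T0 + T - 2 * \<Delta>)) * sqrt (T - 3 * \<Delta>))))
       in (\<forall>\<sigma>. \<epsilon>tail \<sigma> \<le> b1 \<sigma>) \<and> Bd \<epsilon>tail \<le> Bd b1 \<and>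
          (3 * \<Delta> < T \<longrightarrow>
             (\<forall>\<sigma>. \<epsilon>tail \<sigma> \<le> b2 \<sigma> \<and> \<epsilon>tail \<sigma> \<le> b3 \<sigma>) \<and> Bd \<epsilon>tail \<le> Bd b2 \<and> Bd \<epsilon>tail \<le> Bd b3)))"
proof -

  \<comment> \<open>Signs, and monotonicity of the error functional\<close>
  let ?p = "(M, a)" and ?X = "X_slice B (M, a)" and ?G = "G_map n W l"
  have l': "l0 \<le> l" "l1 \<le> l" "0 < l" using l by auto
  have zpos: "0 < cmod (z \<sigma>)" for \<sigma> by (simp add: z_def mode_factor_def)
  have Cstar: "0 < Cstar" using A4 by (simp add: inverse_map_def)
  have \<nu>: "0 < \<nu>" using A1 by (simp add: two_mode_model_def separating_line_def)
  have im: "Im (W n \<sigma> l ?p) \<le> 0" for \<sigma>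
    using poles true_param l(3) unfolding equatorial_qnms_def by blast
  \<comment> \<open>The coefficients of \<open>Bd\<close> are nonnegative, so every bound on the
    relative sizes transfers to the parameter error.\<close>
  have Bd_mono: "Bd e \<le> Bd e'" if "\<And>\<sigma>. e \<sigma> \<le> e' \<sigma>" for e e'
    unfolding Bd_def using that zpos Cstar window(2) l'
    by (intro mult_left_mono add_mono divide_right_mono) (auto simp: less_imp_le)
  have Bd_add: "Bd (\<lambda>\<sigma>. e \<sigma> + e' \<sigma>) = Bd e + Bd e'" for e e'
    unfolding Bd_def by (simp add: add_divide_distrib algebra_simps)

  \<comment> \<open>From frequency errors to the parameter error\<close>
  have freq: "cmod (\<omega>h \<sigma> - W n \<sigma> l ?p) \<le> 10 / (\<Delta> * cmod (z \<sigma>)) * \<epsilon> \<sigma>" for \<sigma>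
    using A3[of \<sigma>] small[of \<sigma>] by (simp add: frequency_extraction_def z_def omega_hat_def Let_def)
  \<comment> \<open>The reconstructed point is a genuine preimage \<open>q\<close> in
    \<open>K \<inter> Nb\<close>, by injectivity there. Since \<open>Nb\<close> lies in the ball of
    radius \<open>rst l\<close>, the stability estimate of \<open>A4\<close> applies to
    \<open>q\<close> and the true point.\<close>
  from in_range obtain q where q: "q \<in> K \<inter> Nb" "?G q = freq_map l (\<omega>h Plus) (\<omega>h Minus)"
    by (metis imageE)
  have ph: "ph = q" unfolding ph_def q(2)[symmetric] by (rule the_inv_into_f_f[OF nbhd(4) q(1)])
  have "dist q ?p < rst l" using q(1) nbhd(3) by (auto simp: dist_commute)
  then have "norm (q - ?p) \<le> Cstar * norm (?G q - ?G ?p)"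
    using A4 l'(1) q(1) true_param unfolding inverse_map_def by blast
  also have "\<dots> \<le> Cstar * ((10 / (\<Delta> * cmod (z Plus)) * \<epsilon> Plus + 10 / (\<Delta> * cmod (z Minus)) * \<epsilon> Minus)
                          / (sqrt 2 * real l))"
  proof (rule mult_left_mono)
    have "norm (?G q - ?G ?p) \<le> (cmod (\<omega>h Plus - W n Plus l ?p) + cmod (\<omega>h Minus - W n Minus l ?p))
                          / (sqrt 2 * real l)"
      using norm_freq_map_diff[OF l'(3)] by (simp only: q(2) G_map_def[of n W l ?p])
    also have "\<dots> \<le> (10 / (\<Delta> * cmod (z Plus)) * \<epsilon> Plus + 10 / (\<Delta> * cmod (z Minus)) * \<epsilon> Minus)
                          / (sqrt 2 * real l)"
      by (intro divide_right_mono add_mono freq) auto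
    finally show "norm (?G q - ?G ?p) \<le> \<dots>" .
  qed (use Cstar in simp)
  also have "\<dots> = (10 / sqrt 2) * Cstar / (\<Delta> * real l) * (\<epsilon> Plus / cmod (z Plus) + \<epsilon> Minus / cmod (z Minus))"
    using zpos[of Plus] zpos[of Minus] window(2) l'(3) by (simp add: field_simps)
  \<comment> \<open>The final constant is the 10 of the frequency bound times the 1 / sqrt 2 of the
    frequency map.\<close>
  also have "10 / sqrt 2 = 5 * sqrt 2" by (simp add: field_simps)
  finally have main: "norm (ph - ?p) \<le> Bd \<epsilon>" by (simp add: Bd_def ph)

  \<comment> \<open>Tail estimates and the splitting of the residual\<close>
  define c where "c m N' = Cst m N' * detector_norm ?X (reg Fl + 1) Ob
      * energy_norm ?X (reg Fl + real m + real (Nloss m N')) d" for m N'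
  define env where "env m N' = (\<lambda>t. exp (- \<nu> * t) / (1 + t) ^ m + 1 / real l ^ N')" for m N' :: nat
  have c_nonneg: "0 \<le> c m N'" for m N'
  proof -
    have "0 < Cst m N'" using A1 by (simp add: two_mode_model_def)
    then show ?thesis using detector_norm_nonneg[OF det] by (simp add: c_def energy_norm_def)
  qed
  have rho_bound: "cmod (\<rho> \<sigma> t) \<le> c m N' * env m N' t"
    if D: "d \<in> data_space B Fl ?p (reg Fl + real m + real (Nloss m N'))" and t: "1 \<le> t" for \<sigma> t m N'
  proof -
    let ?E = "remainder B Fl n Ws W Amp ?p \<sigma> l d t"
    have E: "sobolev ?X (reg Fl + 1) ?E"
      "sobolev_norm ?X (reg Fl + 1) ?E
         \<le> Cst m N' * env m N' t * energy_norm ?X (reg Fl + real m + real (Nloss m N')) d"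
      using A1 true_param l'(2) D t unfolding two_mode_model_def Let_def env_def by blast+
    have "cmod (\<rho> \<sigma> t) \<le> detector_norm ?X (reg Fl + 1) Ob * sobolev_norm ?X (reg Fl + 1) ?E"
      unfolding rho_def by (rule detector_bound[OF det E(1)])
    also have "\<dots> \<le> detector_norm ?X (reg Fl + 1) Ob
        * (Cst m N' * env m N' t * energy_norm ?X (reg Fl + real m + real (Nloss m N')) d)"
      by (intro mult_left_mono E(2) detector_norm_nonneg[OF det])
    finally show ?thesis by (simp add: c_def mult_ac)
  qed
  have env_cont: "continuous_on {T0..T0 + T} (env m N')" for m N'
    unfolding env_def using window(1) by (intro continuous_intros) auto
  have env_nonneg: "0 \<le> env m N' t" if "0 \<le> t" for m N' t
    unfolding env_def using that by simp
  \<comment> \<open>The envelope is largest at the start of the window; this is what gives the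
    closed form of \<open>b3\<close>.\<close>
  have env_le: "env m N' t \<le> env m N' T0" if "T0 \<le> t" for m N' t
    unfolding env_def using that window(1) \<nu> l'(3)
    by (intro add_mono frac_le power_mono) auto
  have rho_L2: "L2_on {T0..T0 + T} (\<rho> \<sigma>)"
    and rho_int: "sqrt (LINT t:{T0..T0 + T}|lebesgue. (cmod (\<rho> \<sigma> t))\<^sup>2)
                    \<le> c m N' * sqrt (LINT t:{T0..T0 + T}|lebesgue. (env m N' t)\<^sup>2)"
    if D: "d \<in> data_space B Fl ?p (reg Fl + real m + real (Nloss m N'))" for \<sigma> m N'
  proof -
    have cont: "continuous_on {T0..T0 + T} (\<lambda>t. c m N' * env m N' t)"
      by (intro continuous_intros env_cont)
    \<comment> \<open>As \<open>T0 \<ge> 1\<close>, the whole window lies in the time range of the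
      tail estimate.\<close>
    have le: "cmod (\<rho> \<sigma> t) \<le> c m N' * env m N' t" if "t \<in> {T0..T0 + T}" for t
      using rho_bound[OF D] that window(1) by simp
    show "L2_on {T0..T0 + T} (\<rho> \<sigma>)" by (rule L2_on_bounded(1)[OF rho_meas cont le])
    have "sqrt (LINT t:{T0..T0 + T}|lebesgue. (cmod (\<rho> \<sigma> t))\<^sup>2)
        \<le> sqrt (LINT t:{T0..T0 + T}|lebesgue. (c m N')\<^sup>2 * (env m N' t)\<^sup>2)"
      using L2_on_bounded(2)[OF rho_meas cont le] by (simp only: real_sqrt_le_iff power_mult_distrib)
    also have "\<dots> = c m N' * sqrt (LINT t:{T0..T0 + T}|lebesgue. (env m N' t)\<^sup>2)"
      using c_nonneg by (simp add: real_sqrt_mult)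
    finally show "sqrt (LINT t:{T0..T0 + T}|lebesgue. (cmod (\<rho> \<sigma> t))\<^sup>2) \<le> \<dots>" .
  qed
  \<comment> \<open>Square integrability of the tail does not involve \<open>m\<close> and
    \<open>N'\<close>, so the single pair supplied by \<open>data\<close> is enough.\<close>
  have \<rho>L2: "L2_on {T0..T0 + T} (\<rho> \<sigma>)" for \<sigma> using data rho_L2 by blast
  have split: "\<epsilon> \<sigma> \<le> \<epsilon>tail \<sigma> + \<epsilon>meas \<sigma>" for \<sigma>
  proof -
    have "r \<sigma> = (\<lambda>t. \<rho> \<sigma> t + \<eta> \<sigma> t)" by (rule ext) (rule r_def)
    then show ?thesis unfolding eps_def eps_tail_def eps_meas_def
      using rel_size_triangle[OF window(4) less_imp_le[OF window(2)] \<rho>L2 eta_L2] by simp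
  qed
  have "Bd \<epsilon> \<le> Bd \<epsilon>tail + Bd \<epsilon>meas" using Bd_mono[of \<epsilon>, OF split] by (simp only: Bd_add)

  \<comment> \<open>Explicit bounds for the tail contribution\<close>
  define num where "num m N' = c m N' * sqrt (LINT t:{T0..T0 + T}|lebesgue. (env m N' t)\<^sup>2)" for m N'
  define J where "J \<sigma> = (LINT t:{T0..T0 + T - \<Delta>}|lebesgue. w t * exp (2 * Im (W n \<sigma> l ?p) * t))" for \<sigma>
  define J' where "J' \<sigma> = (LINT t:{T0 + \<Delta>..T0 + T - 2 * \<Delta>}|lebesgue. exp (2 * Im (W n \<sigma> l ?p) * t))" for \<sigma>
  have wy0: "wnorm T0 T \<Delta> w (y0 \<sigma>) = cmod (amp \<sigma>) * sqrt (J \<sigma>)" for \<sigma>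
    unfolding J_def y0_def[abs_def] by (rule wnorm_mode)
  have D_pos: "0 < cmod (amp \<sigma>) * sqrt (J \<sigma>)" for \<sigma>
    using wnorm_nonneg[OF window(4), of "y0 \<sigma>"] y0_nz[of \<sigma>] by (simp flip: wy0)
  have num_nonneg: "0 \<le> num m N'" for m N'
    unfolding num_def set_lebesgue_integral_def
    by (intro mult_nonneg_nonneg c_nonneg real_sqrt_ge_zero Bochner_Integration.integral_nonneg) simp
  have num_le: "num m N' \<le> c m N' * sqrt T * env m N' T0" for m N'
  proof -
    have "(LINT t:{T0..T0 + T}|lebesgue. (env m N' t)\<^sup>2) \<le> (LINT t:{T0..T0 + T}|lebesgue. (env m N' T0)\<^sup>2)"
      using window(1) env_nonneg env_le
      by (intro set_integral_mono absolutely_integrable_continuous_real continuous_intros env_cont power_mono) auto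
    also have "\<dots> = T * (env m N' T0)\<^sup>2" using window by (simp add: set_integral_const)
    finally have "sqrt (LINT t:{T0..T0 + T}|lebesgue. (env m N' t)\<^sup>2) \<le> sqrt (T * (env m N' T0)\<^sup>2)"
      by (rule real_sqrt_le_mono)
    also have "\<dots> = sqrt T * env m N' T0"
      using env_nonneg[of T0] window(1) by (simp add: real_sqrt_mult)
    finally show ?thesis unfolding num_def mult.assoc by (rule mult_left_mono) (rule c_nonneg)
  qed
  have b1: "\<epsilon>tail \<sigma> \<le> num m N' / (cmod (amp \<sigma>) * sqrt (J \<sigma>))"
    if D: "d \<in> data_space B Fl ?p (reg Fl + real m + real (Nloss m N'))" for \<sigma> m N'
    unfolding eps_tail_def rel_size_def wy0
  proof (rule divide_right_mono)
    show "max (wnorm T0 T \<Delta> w (\<rho> \<sigma>)) (wnorm T0 T \<Delta> w (shift \<Delta> (\<rho> \<sigma>))) \<le> num m N'"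
      unfolding num_def
      using wnorm_window(3)[OF window(4) less_imp_le[OF window(2)] \<rho>L2] rho_int[OF D]
      by (rule order_trans)
  qed (use D_pos in \<open>simp add: less_imp_le\<close>)
  \<comment> \<open>The chain \<open>e \<le> sqrt (J' \<sigma>) \<le> sqrt (J \<sigma>)\<close> of
    lower bounds for the mode makes the estimate weaker but more explicit. The inner window has
    length \<open>T - 3 * \<Delta>\<close>, which is positive here, so \<open>e\<close> is positive
    and no denominator vanishes.\<close>
  have b23: "num m N' / (cmod (amp \<sigma>) * sqrt (J \<sigma>)) \<le> num m N' / (cmod (amp \<sigma>) * sqrt (J' \<sigma>))"
    "num m N' / (cmod (amp \<sigma>) * sqrt (J' \<sigma>)) \<le> c m N' * sqrt T * env m N' T0 / (cmod (amp \<sigma>) *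
        (exp (Im (W n \<sigma> l ?p) * (T0 + T - 2 * \<Delta>)) * sqrt (T - 3 * \<Delta>)))"
    if T: "3 * \<Delta> < T" for \<sigma> m N'
  proof -
    define e where "e = exp (Im (W n \<sigma> l ?p) * (T0 + T - 2 * \<Delta>)) * sqrt (T - 3 * \<Delta>)"
    have "(T - 3 * \<Delta>) * exp (2 * Im (W n \<sigma> l ?p) * (T0 + T - 2 * \<Delta>)) \<le> J' \<sigma>"
      using exp_integral_lower[of "T0 + \<Delta>" "T0 + T - 2 * \<Delta>" "Im (W n \<sigma> l ?p)"] im T
      by (simp add: J'_def algebra_simps)
    moreover have "sqrt ((T - 3 * \<Delta>) * exp (2 * Im (W n \<sigma> l ?p) * (T0 + T - 2 * \<Delta>))) = e"
      by (simp add: e_def real_sqrt_mult exp_double mult.assoc)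
    ultimately have e_le: "e \<le> sqrt (J' \<sigma>)" using real_sqrt_le_mono by metis
    have e_pos: "0 < e" using T by (simp add: e_def)
    have J'_pos: "0 < J' \<sigma>" using less_le_trans[OF e_pos e_le] by simp
    have "J' \<sigma> \<le> J \<sigma>"
      unfolding J_def J'_def using window(2) T by (intro mode_window_lower[OF window(4)]) auto
    then show "num m N' / (cmod (amp \<sigma>) * sqrt (J \<sigma>)) \<le> num m N' / (cmod (amp \<sigma>) * sqrt (J' \<sigma>))"
      using J'_pos A2[of \<sigma>] by (intro divide_left_mono num_nonneg mult_left_mono mult_pos_pos) auto
    show "num m N' / (cmod (amp \<sigma>) * sqrt (J' \<sigma>)) \<le> c m N' * sqrt T * env m N' T0 / (cmod (amp \<sigma>) *
        (exp (Im (W n \<sigma> l ?p) * (T0 + T - 2 * \<Delta>)) * sqrt (T - 3 * \<Delta>)))"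
      unfolding e_def[symmetric]
      using num_le[of m N'] num_nonneg[of m N'] e_le e_pos A2[of \<sigma>]
      by (intro frac_le mult_left_mono mult_pos_pos) auto
  qed
  have b2: "\<epsilon>tail \<sigma> \<le> num m N' / (cmod (amp \<sigma>) * sqrt (J' \<sigma>))"
    and b3: "\<epsilon>tail \<sigma> \<le> c m N' * sqrt T * env m N' T0 / (cmod (amp \<sigma>) *
        (exp (Im (W n \<sigma> l ?p) * (T0 + T - 2 * \<Delta>)) * sqrt (T - 3 * \<Delta>)))"
    if "d \<in> data_space B Fl ?p (reg Fl + real m + real (Nloss m N'))" "3 * \<Delta> < T" for \<sigma> m N'
    using b1[OF that(1)] b23[OF that(2)] by (meson order_trans)+
  \<comment> \<open>Unfolding \<open>Let\<close> leaves the envelope only in applied form, so its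
    definition is folded back pointwise.\<close>
  show ?thesis
    unfolding Let_def J_def[symmetric] J'_def[symmetric] c_def[symmetric]
      fun_cong[OF env_def, symmetric] num_def[symmetric]
    using main split \<open>Bd \<epsilon> \<le> _\<close> b1 b2 b3 by (auto intro!: Bd_mono)
qed

end
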